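(* Let $f=\sum_{t=1}^k a_t\tau_t$ with $a_t\ge 0$ and each $\tau_t$ a layered permutation, and let $(W_n)_{n\geq 1}$ be a sequence of sets with $W_n\subset[n]$ for every $n$. Then \[ \lim_{n\to\infty}\mathfrak{L}_{n,W_n,f} = p(f). \]
   Context: $\mathfrak{S}_n$ is the set of permutations of $[n]$, $|\sigma|=n$ for $\sigma\in\mathfrak{S}_n$. For $\tau\in\mathfrak{S}_m$, $\sigma\in\mathfrak{S}_n$, $p(\tau,\sigma)$ is $\binom{n}{m}^{-1}$ times the number of $m$-subsets $A=\{i_1<\cdots<i_m\}\subset[n]$ such that the pattern of $(\sigma(i_1),\ldots,\sigma(i_m))$ is $\tau$ (and $0$ if $m>n$), extended linearly in the first argument; $p(f)=\lim_{N\to\infty}\max\{p(f,\sigma):\sigma\in\mathfrak{S}_N\}$. A permutation is layered with layer sequence $(r_1,\ldots,r_m)$ if it is the concatenation of decreasing runs of consecutive values of lengths $r_1,\ldots,r_m$, each run's values below all later runs' values. An antilayer is a maximal contiguous nonempty sequence of layers of length $1$; an antilayeroid is a contiguous nonempty subsequence of an antilayer. A quasi-block decomposition of a layered $\tau\in\mathfrak{S}_m$ is a sequence $(\ell_i,\xi_i)_{i=1}^k$ in $\mathbb{N}^*\times\{0,1\}$ with $\sum_i\ell_i=m$ such that for each $i$ the set of positions $\{\sum_{j<i}\ell_j+t: t\in[\ell_i]\}$ is a layer of $\tau$ with $\ell_i\ge 2$ if $\xi_i=0$, and is an antilayeroid of $\tau$ if $\xi_i=1$; $\mathfrak{Q}_\tau$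 is the set of all of them. The Extended Price Polynomial of order $n$ for layered $\tau\in\mathfrak{S}_m$ is \[g_{n,\tau}(x_1,\ldots,x_{2n}) = m!\sum_{(\ell_j,\xi_j)_{j=1}^k\in\mathfrak{Q}_\tau}\ \sum_{\{i_1<\cdots<i_k\}\subset[2n]}\ \prod_{j=1}^k\frac{x_{i_j}^{\ell_j}}{\ell_j!}\mathbb{1}_{\{i_j\bmod 2=\xi_j\text{ or }\ell_j=1\}},\] extended linearly: $g_{n,f}=\sum_t a_tg_{n,\tau_t}$. For $W\subset[n]$, the Extended Price Bound is $\mathfrak{L}_{n,W,f}=\max\{g_{n,f}(x_1,\ldots,x_{2n}): \sum_{j=1}^{2n}x_j=1,\ x_j\ge0 \ \forall j\in[2n],\ x_{2j-1}=0\ \forall j\in W\}$. *)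

theory Defs
  imports Complex_Main "HOL-Library.Poly_Mapping" "HOL-Combinatorics.Multiset_Permutations"
begin

text \<open>Permutations of \<open>{1..n}\<close> are lists in one-line notation. Values are numbered from 1;
  positions are list indices, hence numbered from 0.\<close>

abbreviation perms :: "nat \<Rightarrow> nat list set" where
  "perms n \<equiv> permutations_of_set {1..n}"

text \<open>A formal real linear combination of permutations is a finitely supported function.\<close>

type_synonym perm_comb = "nat list \<Rightarrow>\<^sub>0 real"

definition linear_ext :: "(nat list \<Rightarrow> real) \<Rightarrow> perm_comb \<Rightarrow> real" where
  "linear_ext F f = (\<Sum>\<tau>\<in>Poly_Mapping.keys f. Poly_Mapping.lookup f \<tau> * F \<tau>)"

text \<open>Each entry is replaced by its rank among the entries (which are distinct in all uses).\<close>

definition pattern :: "nat list \<Rightarrow> nat list" where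
  "pattern xs = map (\<lambda>x. card {y \<in> set xs. y \<le> x}) xs"

text \<open>If \<open>\<tau>\<close> is longer than \<open>\<sigma>\<close>, then the value is 0, by division by zero.\<close>

definition pattern_density :: "nat list \<Rightarrow> nat list \<Rightarrow> real" where
  "pattern_density \<tau> \<sigma> =
     real (card {A. A \<subseteq> {..<length \<sigma>} \<and> card A = length \<tau> \<and> pattern (nths \<sigma> A) = \<tau>})
       / real (length \<sigma> choose length \<tau>)"

definition packing_density :: "perm_comb \<Rightarrow> real" where
  "packing_density f =
     lim (\<lambda>N. Max ((\<lambda>\<sigma>. linear_ext (\<lambda>\<tau>. pattern_density \<tau> \<sigma>) f) ` perms N))"

definition layer_sequence :: "nat list \<Rightarrow> nat list \<Rightarrow> bool" where
  "layer_sequence \<tau> rs \<longleftrightarrow>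
     \<tau> \<in> perms (length \<tau>) \<and>
     (\<exists>runs. \<tau> = concat runs \<and> rs = map length runs \<and>
        (\<forall>u\<in>set runs. u \<noteq> [] \<and> (\<exists>a. u = rev [a..<a + length u])) \<and>
        sorted_wrt (\<lambda>u v. \<forall>x\<in>set u. \<forall>y\<in>set v. x < y) runs)"

definition layered :: "nat list \<Rightarrow> bool" where
  "layered \<tau> \<longleftrightarrow> (\<exists>rs. layer_sequence \<tau> rs)"

text \<open>The positions occupied by the \<open>i\<close>-th of consecutive blocks with lengths \<open>ls\<close>.\<close>

definition block :: "nat list \<Rightarrow> nat \<Rightarrow> nat set" where
  "block ls i = {sum_list (take i ls)..<sum_list (take i ls) + ls ! i}"

definition unit_layers :: "nat list \<Rightarrow> nat \<Rightarrow> nat \<Rightarrow> bool" where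
  "unit_layers rs a b \<longleftrightarrow> a < b \<and> b \<le> length rs \<and> (\<forall>i\<in>{a..<b}. rs ! i = 1)"

text \<open>Antilayers and antilayeroids of a layer sequence are given as ranges \<open>{a..<b}\<close> of layer indices.\<close>

definition antilayer :: "nat list \<Rightarrow> nat \<Rightarrow> nat \<Rightarrow> bool" where
  "antilayer rs a b \<longleftrightarrow>
     unit_layers rs a b \<and>
     (\<forall>a' b'. unit_layers rs a' b' \<and> a' \<le> a \<and> b \<le> b' \<longrightarrow> a' = a \<and> b' = b)"

definition antilayeroid :: "nat list \<Rightarrow> nat \<Rightarrow> nat \<Rightarrow> bool" where
  "antilayeroid rs c d \<longleftrightarrow> c < d \<and> (\<exists>a b. antilayer rs a b \<and> a \<le> c \<and> d \<le> b)"

text \<open>Layers and antilayeroids of a permutation as sets of positions.\<close>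

definition is_layer :: "nat list \<Rightarrow> nat set \<Rightarrow> bool" where
  "is_layer \<tau> P \<longleftrightarrow> (\<exists>rs i. layer_sequence \<tau> rs \<and> i < length rs \<and> P = block rs i)"

definition is_antilayeroid :: "nat list \<Rightarrow> nat set \<Rightarrow> bool" where
  "is_antilayeroid \<tau> P \<longleftrightarrow>
     (\<exists>rs c d. layer_sequence \<tau> rs \<and> antilayeroid rs c d \<and> P = (\<Union>i\<in>{c..<d}. block rs i))"

definition quasi_block_decomps :: "nat list \<Rightarrow> (nat \<times> nat) list set" where
  "quasi_block_decomps \<tau> =
     {q. (\<forall>(l, \<xi>)\<in>set q. l > 0 \<and> \<xi> \<in> {0, 1}) \<and>
         sum_list (map fst q) = length \<tau> \<and>
         (\<forall>i<length q.
            (snd (q ! i) = 0 \<longrightarrow> is_layer \<tau> (block (map fst q) i) \<and> fst (q ! i) \<ge> 2) \<and>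
            (snd (q ! i) = 1 \<longrightarrow> is_antilayeroid \<tau> (block (map fst q) i)))}"

text \<open>The variables \<open>x 1, \<dots>, x (2 * n)\<close> are numbered from 1, as their parity matters.\<close>

definition price_poly :: "nat \<Rightarrow> nat list \<Rightarrow> (nat \<Rightarrow> real) \<Rightarrow> real" where
  "price_poly n \<tau> x =
     fact (length \<tau>) *
       (\<Sum>q\<in>quasi_block_decomps \<tau>. \<Sum>I | I \<subseteq> {1..2 * n} \<and> card I = length q.
          \<Prod>j<length q.
            let i = sorted_list_of_set I ! j; l = fst (q ! j); \<xi> = snd (q ! j)
            in x i ^ l / fact l * of_bool (i mod 2 = \<xi> \<or> l = 1))"

definition price_poly_comb :: "nat \<Rightarrow> perm_comb \<Rightarrow> (nat \<Rightarrow> real) \<Rightarrow> real" where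
  "price_poly_comb n f x = linear_ext (\<lambda>\<tau>. price_poly n \<tau> x) f"

definition feasible :: "nat \<Rightarrow> nat set \<Rightarrow> (nat \<Rightarrow> real) set" where
  "feasible n W =
     {x. (\<Sum>j=1..2 * n. x j) = 1 \<and> (\<forall>j\<in>{1..2 * n}. x j \<ge> 0) \<and> (\<forall>j\<in>W. x (2 * j - 1) = 0)}"

text \<open>For \<open>n \<ge> 1\<close> the maximum is attained: the polynomial depends only on
  \<open>x 1, \<dots>, x (2 * n)\<close>, and these range over a nonempty compact set.\<close>

definition price_bound :: "nat \<Rightarrow> nat set \<Rightarrow> perm_comb \<Rightarrow> real" where
  "price_bound n W f = (GREATEST y. y \<in> price_poly_comb n f ` feasible n W)"

end

(* Points of a permutation that form an inversion are incomparable in the order "to the right and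
   above". Occurrences of a layered pattern can be read off this order, and two incomparable
   points of an occurrence lie in the same layer of it. Hence Zykov symmetrization applies:
   replacing one of two incomparable points by a copy of the other, in the better of the two
   directions, never decreases the weighted number of occurrences, and a suitable extremal order is
   a weak order, that is, a layered permutation. Its layer sizes, divided by N and assigned to the
   variables of even index, make the price polynomial almost as large as the maximal density M(N).

   Conversely, for weights x summing to 1, the price polynomial is exactly the expected density in
   a permutation of size N whose points are distributed independently among the 2n blocks with
   probabilities x. So every price bound is at most M(N). Both sequences therefore converge to the
   infimum of the M(N), and the constraints given by the sets W(n) are irrelevant since the first
   construction only uses even indices. *)

theory Submission
  imports Defs "HOL-Analysis.Function_Topology"
begin

text \<open>Written through quasi-block decompositions, the price polynomial hides its meaning.
  Expanded, it is a sum over words of length m in the letters 1 to 2n: equal even letters stand for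
  points of one layer, equal odd letters for an increasing run of points. A single point is both at
  once, hence the clause l = 1. A word determines its decomposition and its set of letters, and m!
  divided by the product of the l_j! is the number of words with given multiplicities. Given this
  identity, the upper bound on the price bounds is an average. The lower bound costs a factor that
  tends to 1, because the polynomial draws points with replacement and the density draws them
  without. Symmetrization runs over strict partial orders on N points instead of permutations.
  Cloning then merely pulls a relation back, no one-line notation has to be rebuilt, and the class
  sizes of the final weak order feed the polynomial directly. For this reason
  \<open>has_layers\<close> is a property of an arbitrary relation on an arbitrary set.\<close>

section \<open>Weak orders on finite sets and their class sizes\<close>

definition has_layers :: "('a \<Rightarrow> 'a \<Rightarrow> bool) \<Rightarrow> 'a set \<Rightarrow> nat list \<Rightarrow> bool" where
  "has_layers R A rs \<longleftrightarrow>
     (\<exists>h. h ` A \<subseteq> {..<length rs} \<and> (\<forall>a\<in>A. \<forall>b\<in>A. R a b \<longleftrightarrow> h a < h b) \<and>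
          (\<forall>i<length rs. card {a \<in> A. h a = i} = rs ! i))"

lemma has_layers_bij:
  assumes bij: "bij_betw \<phi> A B"
    and R: "\<And>a b. a \<in> A \<Longrightarrow> b \<in> A \<Longrightarrow> R a b \<longleftrightarrow> S (\<phi> a) (\<phi> b)"
  shows "has_layers R A rs \<longleftrightarrow> has_layers S B rs"
proof
  assume "has_layers R A rs"
  then obtain h where h: "h ` A \<subseteq> {..<length rs}" "\<forall>a\<in>A. \<forall>b\<in>A. R a b \<longleftrightarrow> h a < h b"
    "\<forall>i<length rs. card {a \<in> A. h a = i} = rs ! i"
    unfolding has_layers_def by blast
  let ?\<psi> = "the_inv_into A \<phi>"
  have inj: "inj_on \<phi> A" and B: "B = \<phi> ` A" using bij by (auto simp: bij_betw_def)
  have \<psi>: "?\<psi> (\<phi> a) = a" if "a \<in> A" for a using that inj by (rule the_inv_into_f_f[rotated])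
  have "card {b \<in> B. h (?\<psi> b) = i} = rs ! i" if "i < length rs" for i
  proof -
    have "{b \<in> B. h (?\<psi> b) = i} = \<phi> ` {a \<in> A. h a = i}"
      using \<psi> by (auto simp: B)
    then show ?thesis using h(3) that inj
      by (simp add: card_image inj_on_subset)
  qed
  then show "has_layers S B rs"
    unfolding has_layers_def using h(1,2) R \<psi>
    by (intro exI[of _ "h \<circ> ?\<psi>"]) (auto simp: B)
next
  assume "has_layers S B rs"
  then obtain h where h: "h ` B \<subseteq> {..<length rs}" "\<forall>a\<in>B. \<forall>b\<in>B. S a b \<longleftrightarrow> h a < h b"
    "\<forall>i<length rs. card {a \<in> B. h a = i} = rs ! i"
    unfolding has_layers_def by blast
  have inj: "inj_on \<phi> A" and B: "B = \<phi> ` A" using bij by (auto simp: bij_betw_def)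
  have "card {a \<in> A. h (\<phi> a) = i} = rs ! i" if "i < length rs" for i
  proof -
    have "{b \<in> B. h b = i} = \<phi> ` {a \<in> A. h (\<phi> a) = i}"
      by (auto simp: B)
    then have "card {b \<in> B. h b = i} = card {a \<in> A. h (\<phi> a) = i}"
      using inj by (simp add: card_image inj_on_subset)
    then show ?thesis using h(3) that by simp
  qed
  then show "has_layers R A rs"
    unfolding has_layers_def using h(1,2) R
    by (intro exI[of _ "h \<circ> \<phi>"]) (auto simp: B)
qed

lemma has_layers_cong:
  assumes "\<And>a b. a \<in> A \<Longrightarrow> b \<in> A \<Longrightarrow> R a b \<longleftrightarrow> S a b"
  shows "has_layers R A rs \<longleftrightarrow> has_layers S A rs"
  using assms by (intro has_layers_bij[of id]) auto

lemma has_layers_card: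
  assumes "has_layers R A rs" "finite A"
  shows "card A = sum_list rs"
proof -
  obtain h where h: "h ` A \<subseteq> {..<length rs}" "\<forall>i<length rs. card {a \<in> A. h a = i} = rs ! i"
    using assms(1) unfolding has_layers_def by blast
  have "card A = (\<Sum>i<length rs. card {a \<in> A. h a = i})"
    using h(1) assms(2) by (subst card_eq_sum, subst sum.group[symmetric]) auto
  also have "\<dots> = sum_list rs" using h(2) by (simp add: sum_list_sum_nth atLeast0LessThan)
  finally show ?thesis .
qed

text \<open>Without empty classes both rank functions are onto initial segments, so they agree by
  induction on rank: if a had different ranks, the smaller of the two values would be taken under
  the other rank function by some b. Comparing b with a gives b a smaller rank than a, where both
  functions already agree, and this is contradictory.\<close>

lemma has_layers_unique:
  assumes "has_layers R A rs" "has_layers R A rs'" "0 \<notin> set rs" "0 \<notin> set rs'"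
  shows "rs = rs'"
proof -
  obtain h where h: "h ` A \<subseteq> {..<length rs}" "\<forall>a\<in>A. \<forall>b\<in>A. R a b \<longleftrightarrow> h a < h b"
    "\<forall>i<length rs. card {a \<in> A. h a = i} = rs ! i"
    using assms(1) unfolding has_layers_def by blast
  obtain h' where h': "h' ` A \<subseteq> {..<length rs'}" "\<forall>a\<in>A. \<forall>b\<in>A. R a b \<longleftrightarrow> h' a < h' b"
    "\<forall>i<length rs'. card {a \<in> A. h' a = i} = rs' ! i"
    using assms(2) unfolding has_layers_def by blast
  have ex: "\<exists>a\<in>A. h a = i" if "i < length rs" for i
  proof -
    have "card {a \<in> A. h a = i} \<noteq> 0" using h(3) that assms(3) by (metis nth_mem)
    then have "{a \<in> A. h a = i} \<noteq> {}" by (metis card.empty)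
    then show ?thesis by blast
  qed
  have ex': "\<exists>a\<in>A. h' a = i" if "i < length rs'" for i
  proof -
    have "card {a \<in> A. h' a = i} \<noteq> 0" using h'(3) that assms(4) by (metis nth_mem)
    then have "{a \<in> A. h' a = i} \<noteq> {}" by (metis card.empty)
    then show ?thesis by blast
  qed
  have eq: "h a = h' a" if "a \<in> A" for a
    using that
  proof (induction "h a" arbitrary: a rule: less_induct)
    case less
    show ?case
    proof (rule ccontr)
      assume "h a \<noteq> h' a"
      then consider "h a < h' a" | "h' a < h a" by linarith
      then show False
      proof cases
        case 1
        then obtain b where b: "b \<in> A" "h' b = h a" using ex'[of "h a"] h'(1) less.prems by fastforce
        then have "h b < h a" using 1 h(2) h'(2) less.prems by auto
        then show False using less.hyps b by auto
      next
        case 2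
        then obtain b where b: "b \<in> A" "h b = h' a" using ex[of "h' a"] h(1) less.prems by fastforce
        then have "h' b = h' a" using less.hyps 2 by auto
        then show False using 2 b h(2) h'(2) less.prems by fastforce
      qed
    qed
  qed
  have im: "h ` A = {..<length rs}" "h' ` A = {..<length rs'}"
    using ex ex' h(1) h'(1) by fastforce+
  have "h ` A = h' ` A" using eq by (intro image_cong) auto
  then have len: "length rs = length rs'" using im by (metis card_lessThan)
  show ?thesis
  proof (rule nth_equalityI[OF len])
    fix i assume i: "i < length rs"
    have "{a \<in> A. h a = i} = {a \<in> A. h' a = i}" using eq by auto
    then have "card {a \<in> A. h a = i} = card {a \<in> A. h' a = i}" by simp
    then show "rs ! i = rs' ! i"
      using h(3)[rule_format, OF i] h'(3)[rule_format, of i] len i by linarith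
  qed
qed

lemma has_layers_append:
  assumes "has_layers R A rs" "has_layers R B ss" "A \<inter> B = {}"
    and "\<And>a b. a \<in> A \<Longrightarrow> b \<in> B \<Longrightarrow> R a b \<and> \<not> R b a"
  shows "has_layers R (A \<union> B) (rs @ ss)"
proof -
  obtain h where h: "h ` A \<subseteq> {..<length rs}" "\<forall>a\<in>A. \<forall>b\<in>A. R a b \<longleftrightarrow> h a < h b"
    "\<forall>i<length rs. card {a \<in> A. h a = i} = rs ! i"
    using assms(1) unfolding has_layers_def by blast
  obtain g where g: "g ` B \<subseteq> {..<length ss}" "\<forall>a\<in>B. \<forall>b\<in>B. R a b \<longleftrightarrow> g a < g b"
    "\<forall>i<length ss. card {a \<in> B. g a = i} = ss ! i"
    using assms(2) unfolding has_layers_def by blast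
  define k where "k a = (if a \<in> A then h a else length rs + g a)" for a
  have kA: "k a = h a" "k a < length rs" if "a \<in> A" for a using that h(1) by (auto simp: k_def)
  have kB: "k b = length rs + g b" "g b < length ss" if "b \<in> B" for b
    using that g(1) assms(3) by (auto simp: k_def)
  have "card {a \<in> A \<union> B. k a = i} = (rs @ ss) ! i" if "i < length (rs @ ss)" for i
  proof (cases "i < length rs")
    case True
    then have "{a \<in> A \<union> B. k a = i} = {a \<in> A. h a = i}" using kA kB by fastforce
    then show ?thesis using h(3) True by (simp add: nth_append)
  next
    case False
    then have "{a \<in> A \<union> B. k a = i} = {a \<in> B. g a = i - length rs}" using kA kB by fastforce
    then show ?thesis using g(3) False that by (simp add: nth_append)
  qed
  moreover have "R a b \<longleftrightarrow> k a < k b" if "a \<in> A \<union> B" "b \<in> A \<union> B" for a b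
    using that assms(4) h(2) g(2) kA kB
    by (smt (verit, best) UnE nat_add_left_cancel_less trans_less_add1 not_less_iff_gr_or_eq)
  moreover have "k ` (A \<union> B) \<subseteq> {..<length (rs @ ss)}"
    using kA kB by fastforce
  ultimately show ?thesis unfolding has_layers_def by blast
qed

lemma has_layers_single:
  assumes "\<And>a b. a \<in> A \<Longrightarrow> b \<in> A \<Longrightarrow> \<not> R a b"
  shows "has_layers R A [card A]"
  unfolding has_layers_def using assms by (intro exI[of _ "\<lambda>_. 0"]) auto

lemma has_layers_replicate:
  fixes A :: "'a :: linorder set"
  assumes "finite A" "\<And>a b. a \<in> A \<Longrightarrow> b \<in> A \<Longrightarrow> R a b \<longleftrightarrow> a < b"
  shows "has_layers R A (replicate (card A) 1)"
  using assms
proof (induction "card A" arbitrary: A)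
  case 0
  then show ?case by (auto simp: has_layers_def)
next
  case (Suc n)
  let ?a = "Min A"
  have ne: "A \<noteq> {}" using Suc.hyps(2) by auto
  then have a: "?a \<in> A" using Suc.prems(1) by simp
  then have A: "A = {?a} \<union> (A - {?a})" by auto
  have n: "n = card (A - {?a})" using Suc.hyps(2) Suc.prems(1) a by simp
  have "has_layers R {?a} [card {?a}]" using Suc.prems a by (intro has_layers_single) auto
  moreover have "has_layers R (A - {?a}) (replicate (card (A - {?a})) 1)"
    using Suc.prems n by (intro Suc.hyps(1)) auto
  moreover have "R ?a b \<and> \<not> R b ?a" if "b \<in> A - {?a}" for b
  proof -
    have "?a \<le> b" "?a \<noteq> b" "b \<in> A" using that Suc.prems(1) by auto
    then show ?thesis using Suc.prems(2) a by force
  qed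
  ultimately have "has_layers R ({?a} \<union> (A - {?a})) ([card {?a}] @ replicate (card (A - {?a})) 1)"
    by (intro has_layers_append) auto
  moreover have "[card {?a}] @ replicate (card (A - {?a})) 1 = replicate (card A) (1 :: nat)"
    by (simp flip: n Suc.hyps(2))
  ultimately show ?case using A by metis
qed

section \<open>Symmetrization\<close>

lemma sum_Pow_insert:
  assumes "finite C" "a \<notin> C"
  shows "(\<Sum>A\<in>Pow (insert a C). F A) = (\<Sum>A\<in>Pow C. F A) + (\<Sum>A\<in>Pow C. F (insert a A))"
proof -
  have inj: "inj_on (insert a) (Pow C)"
    using assms(2) by (intro inj_onI) (metis PowD insert_ident subsetD)
  have "Pow C \<inter> insert a ` Pow C = {}" using assms(2) by blast
  then have "(\<Sum>A\<in>Pow (insert a C). F A) = (\<Sum>A\<in>Pow C. F A) + (\<Sum>A\<in>insert a ` Pow C. F A)"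
    unfolding Pow_insert using assms(1) by (intro sum.union_disjoint) auto
  then show ?thesis using inj by (simp add: sum.reindex)
qed

text \<open>In a weak order incomparable points have equal rank, and all comparisons depend on the
  rank alone.\<close>

lemma has_layers_twins:
  assumes "has_layers R A rs" "u \<in> A" "v \<in> A" "w \<in> A" "\<not> R u v" "\<not> R v u"
  shows "R u w \<longleftrightarrow> R v w" "R w u \<longleftrightarrow> R w v"
  using assms unfolding has_layers_def by (metis nat_neq_iff)+

context
  fixes V :: "'a set" and K :: "'k set" and weight :: "'k \<Rightarrow> real" and rs :: "'k \<Rightarrow> nat list"
  assumes fin: "finite V" and nonneg: "\<And>k. k \<in> K \<Longrightarrow> weight k \<ge> 0"
begin

text \<open>In the application \<open>K\<close> is the set of patterns in f and the weight of \<tau>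
  is its coefficient divided by the number of sets of size |\<tau>|. The total score of
  \<open>up \<sigma>\<close> is then the density of f in \<sigma>.\<close>

definition score :: "('a \<Rightarrow> 'a \<Rightarrow> bool) \<Rightarrow> 'a set \<Rightarrow> real" where
  "score R A = (\<Sum>k\<in>K. weight k * of_bool (has_layers R A (rs k)))"

definition total_score :: "('a \<Rightarrow> 'a \<Rightarrow> bool) \<Rightarrow> real" where
  "total_score R = (\<Sum>A\<in>Pow V. score R A)"

lemma score_bij:
  assumes "bij_betw \<phi> A B" "\<And>a b. a \<in> A \<Longrightarrow> b \<in> A \<Longrightarrow> R a b \<longleftrightarrow> S (\<phi> a) (\<phi> b)"
  shows "score R A = score S B"
  unfolding score_def
  using has_layers_bij[OF assms(1), of R S] assms(2) by (intro sum.cong) auto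

lemma total_score_cong:
  assumes "\<And>a b. a \<in> V \<Longrightarrow> b \<in> V \<Longrightarrow> R a b \<longleftrightarrow> S a b"
  shows "total_score R = total_score S"
  unfolding total_score_def using assms
  by (intro sum.cong score_bij[of id]) auto

lemma total_score_eq:
  "total_score R = (\<Sum>k\<in>K. weight k * real (card {A. A \<subseteq> V \<and> has_layers R A (rs k)}))"
proof -
  have "(\<Sum>A\<in>Pow V. of_bool (has_layers R A (rs k))) = real (card {A. A \<subseteq> V \<and> has_layers R A (rs k)})"
    for k
    using fin by (simp add: of_bool_def sum.If_cases Int_def Pow_def)
  then show ?thesis
    unfolding total_score_def score_def
    by (subst sum.swap) (simp add: sum_distrib_left[symmetric])
qed

text \<open>The score of the sets that contain u but not v. This is what cloning trades: overwriting
  v by u gains the value at u and loses the value at v.\<close>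

definition partial_score :: "('a \<Rightarrow> 'a \<Rightarrow> bool) \<Rightarrow> 'a \<Rightarrow> 'a \<Rightarrow> real" where
  "partial_score R u v = (\<Sum>A\<in>Pow (V - {u, v}). score R (insert u A))"

text \<open>The pullback of R along the map that moves v onto u, so irreflexivity and transitivity
  are inherited immediately.\<close>

definition clone :: "('a \<Rightarrow> 'a \<Rightarrow> bool) \<Rightarrow> 'a \<Rightarrow> 'a \<Rightarrow> ('a \<Rightarrow> 'a \<Rightarrow> bool)" where
  "clone R u v a b = R (if a = v then u else a) (if b = v then u else b)"

text \<open>Two incomparable points can lie in a common occurrence of a layered pattern only if they are
  in the same layer, where replacing one by a copy of the other changes nothing.\<close>

lemma total_score_clone:
  assumes uv: "u \<in> V" "v \<in> V" "u \<noteq> v" "\<not> R u v" "\<not> R v u" and irr: "\<not> R u u" "\<not> R v v"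
  shows "total_score (clone R u v) \<ge> total_score R + partial_score R u v - partial_score R v u"
proof -
  let ?C = "V - {u, v}" and ?R = "clone R u v"
  have V: "V = insert u (insert v ?C)" using uv by auto
  \<comment> \<open>Subsets of V are sorted by which of u and v they contain.\<close>
  have split: "total_score S = (\<Sum>A\<in>Pow ?C. score S A) + (\<Sum>A\<in>Pow ?C. score S (insert v A))
     + ((\<Sum>A\<in>Pow ?C. score S (insert u A)) + (\<Sum>A\<in>Pow ?C. score S (insert u (insert v A))))" for S
    unfolding total_score_def
    by (subst V, subst sum_Pow_insert) (use fin uv in \<open>auto simp: sum_Pow_insert\<close>)
  have 1: "score ?R A = score R A" if "A \<in> Pow ?C" for A
    using that by (intro score_bij[of id]) (auto simp: clone_def)
  have 2: "score ?R (insert u A) = score R (insert u A)" if "A \<in> Pow ?C" for A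
    using that uv by (intro score_bij[of id]) (auto simp: clone_def)
  \<comment> \<open>Sets with v but without u behave in the clone like the same sets with u in place
    of v.\<close>
  have 3: "score ?R (insert v A) = score R (insert u A)" if A: "A \<in> Pow ?C" for A
  proof (rule score_bij[of "\<lambda>a. if a = v then u else a"])
    show "bij_betw (\<lambda>a. if a = v then u else a) (insert v A) (insert u A)"
      using A by (auto simp: bij_betw_def inj_on_def)
  qed (auto simp: clone_def)
  \<comment> \<open>If a set with both points is an occurrence, then u and v are twins inside it and
    the clone coincides with R there. New occurrences may appear, hence only an inequality.\<close>
  have 4: "score ?R (insert u (insert v A)) \<ge> score R (insert u (insert v A))" if A: "A \<in> Pow ?C" for A
    unfolding score_def
  proof (intro sum_mono mult_left_mono)
    fix k assume "k \<in> K"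
    let ?B = "insert u (insert v A)"
    have "has_layers ?R ?B (rs k)" if hl: "has_layers R ?B (rs k)"
    proof -
      have tw: "R u w \<longleftrightarrow> R v w" "R w u \<longleftrightarrow> R w v" if "w \<in> ?B" for w
        using has_layers_twins[OF hl, of u v w] uv(4,5) that by blast+
      have "R a b \<longleftrightarrow> ?R a b" if "a \<in> ?B" "b \<in> ?B" for a b
        using tw(1)[OF that(2)] tw(2)[OF that(1)] irr unfolding clone_def
        by (cases "a = v"; cases "b = v") simp_all
      then have "has_layers R ?B (rs k) \<longleftrightarrow> has_layers ?R ?B (rs k)" by (rule has_layers_cong)
      then show ?thesis using hl by blast
    qed
    then show "of_bool (has_layers R ?B (rs k)) \<le> (of_bool (has_layers ?R ?B (rs k)) :: real)"
      by simp
  qed (use nonneg in auto)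
  have "(\<Sum>A\<in>Pow ?C. score R (insert u (insert v A))) \<le> (\<Sum>A\<in>Pow ?C. score ?R (insert u (insert v A)))"
    using 4 by (rule sum_mono)
  moreover have "partial_score R v u = (\<Sum>A\<in>Pow ?C. score R (insert v A))"
    unfolding partial_score_def by (simp add: insert_commute)
  ultimately show ?thesis
    using 1 2 3 unfolding split[of R] split[of ?R] partial_score_def by simp
qed

definition twins :: "('a \<Rightarrow> 'a \<Rightarrow> bool) \<Rightarrow> 'a \<Rightarrow> 'a set" where
  "twins R a = {b \<in> V. \<forall>w\<in>V. (R a w \<longleftrightarrow> R b w) \<and> (R w a \<longleftrightarrow> R w b)}"

text \<open>The sum counts ordered pairs of twins. Pairs that avoid v survive the cloning. The point
  v leaves a class of size q, with at most 2q - 1 ordered pairs lost, and joins one of size p \<ge>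
  q, with at least 2p + 1 gained.\<close>

lemma clone_twins:
  assumes uv: "u \<in> V" "v \<in> V" "u \<noteq> v" "v \<notin> twins R u" "card (twins R v) \<le> card (twins R u)"
  shows "(\<Sum>a\<in>V. card (twins R a)) < (\<Sum>a\<in>V. card (twins (clone R u v) a))"
proof -
  let ?R = "clone R u v"
  have fin': "finite (twins S a)" for S a using fin by (auto simp: twins_def)
  have old: "twins R a - {v} \<subseteq> twins ?R a" if "a \<in> V - {v}" for a
    using that uv by (auto simp: twins_def clone_def)
  have sym: "v \<in> twins R a \<longleftrightarrow> a \<in> twins R v" if "a \<in> V" for a
    using that uv by (auto simp: twins_def)
  have new: "v \<in> twins ?R a" if "a \<in> twins R u" for a
    using that uv by (auto simp: twins_def clone_def)
  have tv: "insert v (twins R u) \<subseteq> twins ?R v"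
    using uv by (auto simp: twins_def clone_def)
  have "card (insert v (twins R u)) \<le> card (twins ?R v)"
    using tv fin' by (rule card_mono[rotated])
  then have cv: "Suc (card (twins R u)) \<le> card (twins ?R v)" using uv fin' by simp
  \<comment> \<open>The class of a loses at most the point v, and it contains v afterwards if a is a
    twin of u.\<close>
  have ca: "card (twins R a) + of_bool (a \<in> twins R u) \<le> card (twins ?R a) + of_bool (a \<in> twins R v)"
    if a: "a \<in> V - {v}" for a
  proof -
    have "card (twins R a) = card (twins R a - {v}) + of_bool (v \<in> twins R a)"
    proof (cases "v \<in> twins R a")
      case True
      then show ?thesis using card.remove[OF fin' True] by (simp del: card_Diff_insert)
    qed simp
    moreover have "card ((twins R a - {v}) \<union> (if a \<in> twins R u then {v} else {})) \<le> card (twins ?R a)"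
      using old[OF a] new fin' by (intro card_mono) auto
    moreover have "card ((twins R a - {v}) \<union> (if a \<in> twins R u then {v} else {}))
        = card (twins R a - {v}) + of_bool (a \<in> twins R u)"
    proof (cases "a \<in> twins R u")
      case True
      have "card (insert v (twins R a - {v})) = Suc (card (twins R a - {v}))"
        using fin' by (intro card_insert_disjoint) auto
      moreover have "twins R a - {v} \<union> {v} = insert v (twins R a - {v})" by blast
      ultimately show ?thesis using True by (simp del: insert_Diff_single card_Diff_insert)
    qed simp
    ultimately show ?thesis using sym a by auto
  qed
  have sub: "twins R u \<subseteq> V - {v}" using uv by (auto simp: twins_def)
  have s: "(\<Sum>a\<in>V - {v}. of_bool (a \<in> S)) = card (S \<inter> (V - {v}))" for S
    using fin by (simp add: of_bool_def sum.If_cases Int_commute)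
  have "(\<Sum>a\<in>V - {v}. card (twins R a) + of_bool (a \<in> twins R u))
      \<le> (\<Sum>a\<in>V - {v}. card (twins ?R a) + of_bool (a \<in> twins R v))"
    using ca by (rule sum_mono)
  then have "(\<Sum>a\<in>V - {v}. card (twins R a)) + card (twins R u) \<le> (\<Sum>a\<in>V - {v}. card (twins ?R a)) + card (twins R v \<inter> (V - {v}))"
    using sub s[of "twins R u"] s[of "twins R v"]
    by (simp add: sum.distrib Int_absorb2)
  moreover have "card (twins R v \<inter> (V - {v})) \<le> card (twins R v)"
    using fin' by (intro card_mono) auto
  moreover have "(\<Sum>a\<in>V. card (twins S a)) = card (twins S v) + (\<Sum>a\<in>V - {v}. card (twins S a))" for S
    by (rule sum.remove[OF fin uv(2)])
  ultimately show ?thesis using cv uv(5) by simp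
qed

text \<open>Among the maximizers of the score, take one with the most pairs of twins: if some incomparable
  pair were not a pair of twins, cloning the point with more twins would produce further ones.\<close>

lemma symmetrization:
  assumes irr: "\<And>a. \<not> R0 a a" and trans: "\<And>a b c. R0 a b \<Longrightarrow> R0 b c \<Longrightarrow> R0 a c"
  shows "\<exists>h. h ` V \<subseteq> {..<card V} \<and> total_score R0 \<le> total_score (\<lambda>a b. h a < (h b :: nat))"
proof -
  \<comment> \<open>Relations become sets of pairs inside V \<times> V, so that only finitely many
    orders compete and maxima exist.\<close>
  define rel where "rel r = (\<lambda>a b. (a, b) \<in> r)" for r :: "('a \<times> 'a) set"
  define P where "P = {r. r \<subseteq> V \<times> V \<and> irrefl r \<and> trans r}"
  define r0 where "r0 = {(a, b). a \<in> V \<and> b \<in> V \<and> R0 a b}"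
  have r0: "r0 \<in> P" "total_score (rel r0) = total_score R0"
    using irr trans by (auto simp: P_def r0_def rel_def irrefl_def intro!: transI total_score_cong)
  have finP: "finite P" by (rule finite_subset[of _ "Pow (V \<times> V)"]) (use fin in \<open>auto simp: P_def\<close>)
  define m where "m = Max (total_score ` rel ` P)"
  have le_m: "total_score (rel r) \<le> m" if "r \<in> P" for r
    unfolding m_def using finP that by (intro Max_ge) auto
  have "m \<in> total_score ` rel ` P"
    unfolding m_def using finP r0(1) by (intro Max_in) auto
  then obtain r1 where r1: "r1 \<in> P" "total_score (rel r1) = m" by auto
  define P' where "P' = {r \<in> P. total_score (rel r) = m}"
  define T where "T r = (\<Sum>a\<in>V. card (twins (rel r) a))" for r
  have "finite P'" "r1 \<in> P'" using finP r1 by (auto simp: P'_def)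
  then have "Max (T ` P') \<in> T ` P'" by (intro Max_in) auto
  then obtain r where r: "r \<in> P'" "T r = Max (T ` P')" by auto
  then have T_max: "T s \<le> T r" if "s \<in> P'" for s
    using \<open>finite P'\<close> that by simp
  have rP: "r \<in> P" and rm: "total_score (rel r) = m" using r by (auto simp: P'_def)
  let ?R = "rel r"
  have irr': "\<not> ?R a a" for a using rP by (auto simp: P_def irrefl_def rel_def)
  have trans': "?R a b \<Longrightarrow> ?R b c \<Longrightarrow> ?R a c" for a b c
    using rP by (auto simp: P_def rel_def dest: transD)
  define cl where "cl u v = {(a, b). a \<in> V \<and> b \<in> V \<and> clone ?R u v a b}" for u v
  have "clone ?R u v a c" if "clone ?R u v a b" "clone ?R u v b c" for u v a b c
    using that unfolding clone_def by (rule trans')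
  moreover have "\<not> clone ?R u v a a" for u v a using irr' by (simp add: clone_def)
  ultimately have cl: "cl u v \<in> P" for u v
    unfolding P_def cl_def irrefl_def trans_def by blast
  have cl_score: "total_score (rel (cl u v)) = total_score (clone ?R u v)" for u v
    by (rule total_score_cong) (auto simp: rel_def cl_def)
  have cl_twins: "T (cl u v) = (\<Sum>a\<in>V. card (twins (clone ?R u v) a))" for u v
    unfolding T_def by (intro sum.cong arg_cong[where f = card]) (auto simp: twins_def rel_def cl_def)
  have twin: "v \<in> twins ?R u" if uv: "u \<in> V" "v \<in> V" "\<not> ?R u v" "\<not> ?R v u" for u v
  proof (rule ccontr)
    assume n: "v \<notin> twins ?R u"
    then have "u \<noteq> v" "u \<notin> twins ?R v" using uv by (auto simp: twins_def)
    \<comment> \<open>The changes in the two directions are bounded below by opposite numbers. As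
      neither clone exceeds the maximum, these numbers vanish and both clones are maximizers
      again.\<close>
    have "total_score (clone ?R u v) \<le> m" "total_score (clone ?R v u) \<le> m"
      using le_m[OF cl] by (simp_all add: cl_score)
    moreover have "total_score (clone ?R u v) \<ge> m + partial_score ?R u v - partial_score ?R v u"
      "total_score (clone ?R v u) \<ge> m + partial_score ?R v u - partial_score ?R u v"
      using total_score_clone[of u v ?R] total_score_clone[of v u ?R] uv \<open>u \<noteq> v\<close> irr' rm by auto
    ultimately have "cl u v \<in> P'" "cl v u \<in> P'"
      using cl by (auto simp: P'_def cl_score)
    then have "T (cl u v) \<le> T r" "T (cl v u) \<le> T r" using T_max by auto
    moreover have "T r = (\<Sum>a\<in>V. card (twins ?R a))" by (simp add: T_def)
    then have "T r < T (cl u v) \<or> T r < T (cl v u)"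
      using clone_twins[of u v ?R] clone_twins[of v u ?R] uv \<open>u \<noteq> v\<close> n \<open>u \<notin> twins ?R v\<close>
      unfolding cl_twins by (cases "card (twins ?R v) \<le> card (twins ?R u)") auto
    ultimately show False by linarith
  qed
  \<comment> \<open>The number of points below a represents the order: twins have the same points
    below them, and a comparable pair gives strictly nested sets. Since a is not below itself, the
    count stays under \<open>card V\<close>.\<close>
  define h where "h a = card {b \<in> V. ?R b a}" for a
  have mono: "h a < h b" if "a \<in> V" "b \<in> V" "?R a b" for a b
    unfolding h_def
  proof (rule psubset_card_mono)
    show "{c \<in> V. ?R c a} \<subset> {c \<in> V. ?R c b}"
      using that irr'[of a] trans'[of _ a b] by blast
  qed (use fin in simp)
  have eq: "h a = h b" if "a \<in> V" "b \<in> V" "\<not> ?R a b" "\<not> ?R b a" for a b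
    unfolding h_def using twin[OF that] by (intro arg_cong[where f = card]) (auto simp: twins_def)
  have "?R a b \<longleftrightarrow> h a < h b" if "a \<in> V" "b \<in> V" for a b
    using that mono eq by (metis less_asym less_irrefl)
  then have "total_score ?R = total_score (\<lambda>a b. h a < h b)" by (rule total_score_cong)
  then have "total_score R0 \<le> total_score (\<lambda>a b. h a < h b)" using le_m[OF r0(1)] r0(2) rm by simp
  moreover have "h a < card V" if "a \<in> V" for a
    unfolding h_def using that fin irr' by (intro psubset_card_mono) auto
  ultimately show ?thesis by (intro exI[of _ h]) auto
qed

end

section \<open>Occurrences of layered patterns\<close>

definition up :: "nat list \<Rightarrow> nat \<Rightarrow> nat \<Rightarrow> bool" where
  "up \<sigma> i j \<longleftrightarrow> i < j \<and> \<sigma> ! i < \<sigma> ! j"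

lemma up_less: "up \<sigma> i j \<Longrightarrow> i < j"
  by (simp add: up_def)

lemma length_pattern [simp]: "length (pattern xs) = length xs"
  by (simp add: pattern_def)

lemma pattern_nth_less_iff:
  assumes "i < length xs" "j < length xs"
  shows "pattern xs ! i < pattern xs ! j \<longleftrightarrow> xs ! i < xs ! j"
proof -
  have less: "card {y \<in> set xs. y \<le> xs ! i} < card {y \<in> set xs. y \<le> xs ! j}"
    if "xs ! i < xs ! j" "j < length xs" for i j
  proof (rule psubset_card_mono)
    have "xs ! j \<in> {y \<in> set xs. y \<le> xs ! j} - {y \<in> set xs. y \<le> xs ! i}" using that by auto
    then show "{y \<in> set xs. y \<le> xs ! i} \<subset> {y \<in> set xs. y \<le> xs ! j}" using that by fastforce
  qed auto
  consider "xs ! i < xs ! j" | "xs ! i = xs ! j" | "xs ! j < xs ! i" by linarith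
  then show ?thesis
    using less[of i j] less[of j i] assms by cases (auto simp: pattern_def)
qed

lemma pattern_nth:
  assumes "distinct xs" "i < length xs"
  shows "pattern xs ! i = card {j. j < length xs \<and> xs ! j \<le> xs ! i}"
proof -
  have "{y \<in> set xs. y \<le> xs ! i} = (!) xs ` {j. j < length xs \<and> xs ! j \<le> xs ! i}"
    by (auto simp: in_set_conv_nth)
  moreover have "inj_on ((!) xs) {j. j < length xs \<and> xs ! j \<le> xs ! i}"
    using assms(1) by (auto simp: inj_on_def nth_eq_iff_index_eq)
  ultimately show ?thesis using assms(2) by (simp add: pattern_def card_image)
qed

lemma pattern_in_perms:
  assumes "distinct xs"
  shows "pattern xs \<in> perms (length xs)"
proof -
  have d: "distinct (pattern xs)"
    unfolding distinct_conv_nth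
  proof safe
    fix i j assume "i < length (pattern xs)" "j < length (pattern xs)" "i \<noteq> j"
      "pattern xs ! i = pattern xs ! j"
    then show False
      using pattern_nth_less_iff[of i xs j] pattern_nth_less_iff[of j xs i] assms
      by (metis length_pattern linorder_neqE_nat nth_eq_iff_index_eq order_less_irrefl)
  qed
  have "set (pattern xs) \<subseteq> {1..length xs}"
  proof
    fix x assume "x \<in> set (pattern xs)"
    then obtain i where i: "i < length xs" "x = card {y \<in> set xs. y \<le> xs ! i}"
      by (auto simp: pattern_def in_set_conv_nth)
    have "xs ! i \<in> {y \<in> set xs. y \<le> xs ! i}" using i by simp
    then have "{y \<in> set xs. y \<le> xs ! i} \<noteq> {}" by blast
    then have "card {y \<in> set xs. y \<le> xs ! i} > 0" by (simp add: card_gt_0_iff)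
    moreover have "card {y \<in> set xs. y \<le> xs ! i} \<le> card (set xs)" by (intro card_mono) auto
    ultimately show "x \<in> {1..length xs}" using i(2) card_length[of xs] by simp
  qed
  moreover have "card (set (pattern xs)) = length xs" using d by (simp add: distinct_card)
  ultimately have "set (pattern xs) = {1..length xs}" by (intro card_subset_eq) auto
  then show ?thesis using d by (simp add: permutations_of_set_def)
qed

lemma permsD:
  assumes "\<sigma> \<in> perms N"
  shows "distinct \<sigma>" "set \<sigma> = {1..N}" "length \<sigma> = N"
  using assms length_finite_permutations_of_set[of \<sigma> "{1..N}"]
  by (auto simp: permutations_of_set_def)

lemma pattern_perms:
  assumes "\<tau> \<in> perms m"
  shows "pattern \<tau> = \<tau>"
proof (rule nth_equalityI)
  fix i assume "i < length (pattern \<tau>)"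
  then have i: "i < length \<tau>" by simp
  then have "\<tau> ! i \<in> {1..m}" using permsD(2)[OF assms] nth_mem by blast
  then have "{y \<in> set \<tau>. y \<le> \<tau> ! i} = {1..\<tau> ! i}" using permsD(2)[OF assms] by auto
  then show "pattern \<tau> ! i = \<tau> ! i" using i by (simp add: pattern_def)
qed simp

text \<open>As entries are distinct, positions i < j that are not related by \<open>up\<close> form
  an inversion. Hence \<open>up\<close> decides every comparison of values.\<close>

lemma pattern_eqI:
  assumes "distinct xs" "distinct ys" "length xs = length ys"
    and "\<And>i j. i < length xs \<Longrightarrow> j < length xs \<Longrightarrow> up xs i j \<longleftrightarrow> up ys i j"
  shows "pattern xs = pattern ys"
proof (rule nth_equalityI)
  fix i assume "i < length (pattern xs)"
  then have i: "i < length xs" by simp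
  have "xs ! j \<le> xs ! i \<longleftrightarrow> ys ! j \<le> ys ! i" if j: "j < length xs" for j
  proof -
    have "xs ! j = xs ! i \<longleftrightarrow> j = i" "ys ! j = ys ! i \<longleftrightarrow> j = i"
      using assms(1-3) i j by (auto simp: nth_eq_iff_index_eq)
    then show ?thesis using assms(4)[OF i j] assms(4)[OF j i] unfolding up_def
      by (cases i j rule: linorder_cases) auto
  qed
  then have "{j. j < length xs \<and> xs ! j \<le> xs ! i} = {j. j < length ys \<and> ys ! j \<le> ys ! i}"
    using assms(3) by auto
  then show "pattern xs ! i = pattern ys ! i"
    using assms i by (simp add: pattern_nth)
qed (use assms in simp)

section \<open>Layer sequences read off the relation \<open>up\<close>\<close>

lemma has_layers_runs:
  assumes "\<forall>u\<in>set runs. u \<noteq> [] \<and> (\<exists>a. u = rev [a..<a + length u])"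
    and "sorted_wrt (\<lambda>u v. \<forall>x\<in>set u. \<forall>y\<in>set v. x < y) runs"
  shows "has_layers (up (concat runs)) {..<length (concat runs)} (map length runs)"
  using assms
proof (induction runs)
  case Nil
  then show ?case by (simp add: has_layers_def)
next
  case (Cons u runs)
  let ?\<tau> = "u @ concat runs" and ?B = "{length u..<length u + length (concat runs)}"
  obtain a where a: "u = rev [a..<a + length u]" using Cons.prems by auto
  have dec: "u ! j < u ! i" if "i < j" "j < length u" for i j
  proof -
    have "rev [a..<a + length u] ! j < rev [a..<a + length u] ! i" using that by (simp add: rev_nth)
    then show ?thesis using a by metis
  qed
  have "has_layers (up ?\<tau>) {..<length u} [card {..<length u}]"
    using dec by (intro has_layers_single) (force simp: up_def nth_append)
  moreover have "has_layers (up ?\<tau>) ?B (map length runs)"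
  proof -
    have "bij_betw ((+) (length u)) {..<length (concat runs)} ?B"
      unfolding bij_betw_def by (auto simp: atLeast0LessThan[symmetric] image_add_atLeastLessThan)
    then have "has_layers (up (concat runs)) {..<length (concat runs)} (map length runs)
        \<longleftrightarrow> has_layers (up ?\<tau>) ?B (map length runs)"
      by (rule has_layers_bij) (auto simp: up_def nth_append)
    then show ?thesis using Cons by simp
  qed
  moreover have "up ?\<tau> i j \<and> \<not> up ?\<tau> j i" if ij: "i \<in> {..<length u}" "j \<in> ?B" for i j
  proof -
    have "concat runs ! (j - length u) \<in> set (concat runs)" using ij by (intro nth_mem) auto
    moreover have "u ! i \<in> set u" using ij by simp
    ultimately have "u ! i < concat runs ! (j - length u)" using Cons.prems(2) by auto
    then show ?thesis using ij by (auto simp: up_def nth_append)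
  qed
  ultimately have "has_layers (up ?\<tau>) ({..<length u} \<union> ?B) ([card {..<length u}] @ map length runs)"
    by (intro has_layers_append) auto
  moreover have "{..<length u} \<union> ?B = {..<length ?\<tau>}" by auto
  ultimately show ?case by simp
qed

lemma layer_sequenceD:
  assumes "layer_sequence \<tau> rs"
  shows "has_layers (up \<tau>) {..<length \<tau>} rs" "0 \<notin> set rs" "\<tau> \<in> perms (length \<tau>)"
proof -
  obtain runs where r: "\<tau> = concat runs" "rs = map length runs"
    "\<forall>u\<in>set runs. u \<noteq> [] \<and> (\<exists>a. u = rev [a..<a + length u])"
    "sorted_wrt (\<lambda>u v. \<forall>x\<in>set u. \<forall>y\<in>set v. x < y) runs"
    using assms unfolding layer_sequence_def by blast
  show "has_layers (up \<tau>) {..<length \<tau>} rs" using has_layers_runs[OF r(3,4)] r(1,2) by simp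
  show "0 \<notin> set rs" using r(2,3) by auto
  show "\<tau> \<in> perms (length \<tau>)" using assms by (simp add: layer_sequence_def)
qed

lemma layer_sequence_unique:
  "layer_sequence \<tau> rs \<Longrightarrow> layer_sequence \<tau> rs' \<Longrightarrow> rs = rs'"
  by (metis has_layers_unique layer_sequenceD(1,2))

lemma layer_sequence_sum_list: "layer_sequence \<tau> rs \<Longrightarrow> sum_list rs = length \<tau>"
  using has_layers_card[OF layer_sequenceD(1)] by fastforce

text \<open>A relation that respects the order of positions has a monotone rank function. Its
  classes are consecutive intervals, and the prefix sums of \<open>rs\<close> are their end
  points.\<close>

lemma has_layers_initial:
  fixes m :: nat
  assumes "has_layers R {..<m} rs" "\<And>a b. a < m \<Longrightarrow> b < m \<Longrightarrow> R a b \<Longrightarrow> a < b"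
  shows "\<exists>h. h ` {..<m} \<subseteq> {..<length rs} \<and> (\<forall>a<m. \<forall>b<m. R a b \<longleftrightarrow> h a < h b) \<and>
    (\<forall>a<m. \<forall>k\<le>length rs. h a < k \<longleftrightarrow> a < sum_list (take k rs))"
proof -
  obtain h where h: "h ` {..<m} \<subseteq> {..<length rs}" "\<forall>a\<in>{..<m}. \<forall>b\<in>{..<m}. R a b \<longleftrightarrow> h a < h b"
    "\<forall>i<length rs. card {a \<in> {..<m}. h a = i} = rs ! i"
    using assms(1) unfolding has_layers_def by blast
  have mono: "h a \<le> h b" if "a \<le> b" "b < m" for a b
    using that h(2) assms(2)[of b a] by (meson le_less_trans lessThan_iff not_less)
  have "h a < k \<longleftrightarrow> a < sum_list (take k rs)" if a: "a < m" "k \<le> length rs" for a k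
  proof -
    \<comment> \<open>\<open>?D\<close> is an initial segment with as many points as the first k
      classes together, so membership of a amounts to comparing a with this number.\<close>
    let ?D = "{a \<in> {..<m}. h a < k}"
    have "card ?D = (\<Sum>i<k. card {a \<in> ?D. h a = i})"
      by (subst card_eq_sum, subst sum.group[symmetric, where g = h and T = "{..<k}"]) auto
    also have "\<dots> = (\<Sum>i<k. rs ! i)"
    proof (rule sum.cong)
      fix i assume "i \<in> {..<k}"
      then have "{a \<in> ?D. h a = i} = {a \<in> {..<m}. h a = i}" "i < length rs" using a by auto
      then show "card {a \<in> ?D. h a = i} = rs ! i" using h(3) by simp
    qed simp
    also have "\<dots> = sum_list (take k rs)"
      using a by (simp add: sum_list_sum_nth atLeast0LessThan)
    finally have c: "card ?D = sum_list (take k rs)" .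
    show ?thesis
    proof
      assume "h a < k"
      then have "{..a} \<subseteq> ?D" using a mono by (auto intro: le_less_trans)
      then have "card {..a} \<le> card ?D" by (intro card_mono) auto
      then show "a < sum_list (take k rs)" using c by simp
    next
      assume *: "a < sum_list (take k rs)"
      show "h a < k"
      proof (rule ccontr)
        assume "\<not> h a < k"
        then have "?D \<subseteq> {..<a}" using mono[of a] by (auto simp: not_less) (meson leI le_trans not_less)
        then have "card ?D \<le> card {..<a}" by (intro card_mono) auto
        then show False using c * by simp
      qed
    qed
  qed
  then show ?thesis using h by (intro exI[of _ h]) auto
qed

text \<open>The prefix sums fix the rank of every position. Together with \<open>pattern_eqI\<close>
  this recovers a layered pattern from its layer sizes alone.\<close>

lemma has_layers_initial_unique:
  fixes m :: nat
  assumes "has_layers R {..<m} rs" "\<And>a b. a < m \<Longrightarrow> b < m \<Longrightarrow> R a b \<Longrightarrow> a < b"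
    and "has_layers S {..<m} rs" "\<And>a b. a < m \<Longrightarrow> b < m \<Longrightarrow> S a b \<Longrightarrow> a < b"
    and "a < m" "b < m"
  shows "R a b \<longleftrightarrow> S a b"
proof -
  obtain h where h: "h ` {..<m} \<subseteq> {..<length rs}" "\<forall>a<m. \<forall>b<m. R a b \<longleftrightarrow> h a < h b"
    "\<forall>a<m. \<forall>k\<le>length rs. h a < k \<longleftrightarrow> a < sum_list (take k rs)"
    using has_layers_initial[OF assms(1,2)] by blast
  obtain g where g: "g ` {..<m} \<subseteq> {..<length rs}" "\<forall>a<m. \<forall>b<m. S a b \<longleftrightarrow> g a < g b"
    "\<forall>a<m. \<forall>k\<le>length rs. g a < k \<longleftrightarrow> a < sum_list (take k rs)"
    using has_layers_initial[OF assms(3,4)] by blast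
  have "h a = g a" if "a < m" for a
  proof -
    have "h a < length rs" "g a < length rs" using that h(1) g(1) by auto
    moreover have "h a < k \<longleftrightarrow> g a < k" if "k \<le> length rs" for k
      using h(3) g(3) \<open>a < m\<close> that by blast
    ultimately show ?thesis by (metis less_eq_Suc_le less_Suc_eq not_less_iff_gr_or_eq order_less_irrefl)
  qed
  then show ?thesis using h(2) g(2) assms(5,6) by auto
qed

lemma nths_eq_map_sorted_list_of_set:
  assumes "A \<subseteq> {..<length xs}"
  shows "nths xs A = map ((!) xs) (sorted_list_of_set A)"
proof -
  have fin: "finite A" using assms finite_subset by blast
  have "nths [0..<length xs] A = sorted_list_of_set A"
  proof (rule sorted_distinct_set_unique)
    show "set (nths [0..<length xs] A) = set (sorted_list_of_set A)"
      using assms fin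
      by (auto simp: set_nths) (metis add.left_neutral lessThan_iff nth_upt subsetD)
  qed (auto intro: sorted_nths)
  then show ?thesis by (metis nths_map map_nth)
qed

text \<open>The bridge from one-line notation to orders. The increasing enumeration of A transports
  \<open>up\<close>, and conversely the class sizes determine \<open>up\<close> on the extracted
  word and therefore its pattern.\<close>

lemma pattern_nths_iff_has_layers:
  assumes \<tau>: "layer_sequence \<tau> rs" and \<sigma>: "\<sigma> \<in> perms N" and A: "A \<subseteq> {..<N}"
  shows "pattern (nths \<sigma> A) = \<tau> \<longleftrightarrow> has_layers (up \<sigma>) A rs"
proof -
  let ?s = "sorted_list_of_set A" and ?ys = "nths \<sigma> A"
  have fin: "finite A" using A finite_subset by blast
  have ys: "?ys = map ((!) \<sigma>) ?s"
    using A permsD(3)[OF \<sigma>] by (intro nths_eq_map_sorted_list_of_set) simp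
  have len: "length ?ys = card A" by (simp add: ys)
  have d: "distinct ?ys" using permsD(1)[OF \<sigma>] by simp
  have up: "up ?ys i j \<longleftrightarrow> up \<sigma> (?s ! i) (?s ! j)" if "i < card A" "j < card A" for i j
  proof -
    have "i < j \<longleftrightarrow> ?s ! i < ?s ! j"
      using that sorted_wrt_iff_nth_less[of "(<)" ?s] strict_sorted_list_of_set[of A]
      by (metis length_sorted_list_of_set linorder_neqE_nat order_less_asym order_less_irrefl)
    then show ?thesis using that by (simp add: ys up_def)
  qed
  have bij: "bij_betw ((!) ?s) {..<card A} A"
    using fin by (intro bij_betw_nth) auto
  have iff: "has_layers (up ?ys) {..<card A} rs \<longleftrightarrow> has_layers (up \<sigma>) A rs"
    using up by (intro has_layers_bij[OF bij]) auto
  show ?thesis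
  proof
    assume p: "pattern ?ys = \<tau>"
    then have len': "length \<tau> = card A" using len by (metis length_pattern)
    have "up \<tau> i j \<longleftrightarrow> up ?ys i j" if "i < card A" "j < card A" for i j
      using that pattern_nth_less_iff[of i ?ys j] len p by (simp add: up_def)
    then have "has_layers (up \<tau>) {..<card A} rs \<longleftrightarrow> has_layers (up ?ys) {..<card A} rs"
      by (intro has_layers_cong) auto
    then show "has_layers (up \<sigma>) A rs" using iff layer_sequenceD(1)[OF \<tau>] len' by simp
  next
    assume hl: "has_layers (up \<sigma>) A rs"
    then have m: "card A = length \<tau>"
      using has_layers_card fin layer_sequence_sum_list[OF \<tau>] by metis
    have "pattern ?ys = pattern \<tau>"
    proof (rule pattern_eqI[OF d])
      show "distinct \<tau>" using layer_sequenceD(3)[OF \<tau>] permsD(1) by blast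
      show "length ?ys = length \<tau>" using len m by simp
      fix i j assume "i < length ?ys" "j < length ?ys"
      then show "up ?ys i j \<longleftrightarrow> up \<tau> i j"
        using layer_sequenceD(1)[OF \<tau>] hl iff len m
        by (intro has_layers_initial_unique[where m = "card A" and rs = rs]) (auto dest: up_less)
    qed
    then show "pattern ?ys = \<tau>" using pattern_perms[OF layer_sequenceD(3)[OF \<tau>]] by simp
  qed
qed

lemma pattern_density_layered:
  assumes \<tau>: "layer_sequence \<tau> rs" and \<sigma>: "\<sigma> \<in> perms N"
  shows "pattern_density \<tau> \<sigma>
    = real (card {A. A \<subseteq> {..<N} \<and> has_layers (up \<sigma>) A rs}) / real (N choose length \<tau>)"
proof -
  have "card A = length \<tau> \<and> pattern (nths \<sigma> A) = \<tau> \<longleftrightarrow> has_layers (up \<sigma>) A rs" if A: "A \<subseteq> {..<N}" for A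
  proof -
    have "has_layers (up \<sigma>) A rs \<Longrightarrow> card A = length \<tau>"
      using has_layers_card[of "up \<sigma>" A rs] layer_sequence_sum_list[OF \<tau>] A finite_subset by fastforce
    then show ?thesis using pattern_nths_iff_has_layers[OF \<tau> \<sigma> A] by blast
  qed
  then have "{A. A \<subseteq> {..<N} \<and> card A = length \<tau> \<and> pattern (nths \<sigma> A) = \<tau>}
      = {A. A \<subseteq> {..<N} \<and> has_layers (up \<sigma>) A rs}" by blast
  then show ?thesis by (simp add: pattern_density_def permsD(3)[OF \<sigma>])
qed

text \<open>The points are listed by X and their Y coordinates replaced by ranks. The same \<sigma>
  serves every \<open>rs\<close>, which matters because f combines several patterns.\<close>

lemma realize_plane_points:
  fixes X Y :: "nat \<Rightarrow> nat"
  assumes X: "inj_on X {..<N}" and Y: "inj_on Y {..<N}"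
  shows "\<exists>\<sigma>\<in>perms N. \<forall>rs. card {A. A \<subseteq> {..<N} \<and> has_layers (up \<sigma>) A rs}
    = card {A. A \<subseteq> {..<N} \<and> has_layers (\<lambda>a b. X a < X b \<and> Y a < Y b) A rs}"
proof -
  define L where "L = sort_key X [0..<N]"
  have L: "distinct L" "set L = {..<N}" "length L = N" "sorted (map X L)"
    by (auto simp: L_def)
  let ?\<phi> = "(!) L" and ?\<sigma> = "pattern (map Y L)"
  have bij: "bij_betw ?\<phi> {..<N} {..<N}" using L by (intro bij_betw_nth) auto
  have "distinct (map Y L)" using L Y by (simp add: distinct_map)
  then have \<sigma>: "?\<sigma> \<in> perms N" using pattern_in_perms[of "map Y L"] L(3) by simp
  have less: "i < j \<longleftrightarrow> X (L ! i) < X (L ! j)" if "i < N" "j < N" for i j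
  proof -
    have "distinct (map X L)" using L X by (simp add: distinct_map)
    then have "sorted_wrt (<) (map X L)" using L(4) by (simp add: strict_sorted_iff)
    then have *: "X (L ! i) < X (L ! j)" if "i < j" "j < N" for i j
      using that L(3) by (auto simp: sorted_wrt_iff_nth_less)
    show ?thesis using *[of i j] *[of j i] that by (metis linorder_neqE_nat order_less_asym order_less_irrefl)
  qed
  have up: "up ?\<sigma> i j \<longleftrightarrow> X (L ! i) < X (L ! j) \<and> Y (L ! i) < Y (L ! j)" if "i < N" "j < N" for i j
    using that less[OF that] pattern_nth_less_iff[of i "map Y L" j] L(3) by (simp add: up_def)
  have "card {A. A \<subseteq> {..<N} \<and> has_layers (up ?\<sigma>) A rs}
    = card {A. A \<subseteq> {..<N} \<and> has_layers (\<lambda>a b. X a < X b \<and> Y a < Y b) A rs}" for rs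
  proof -
    have iff: "has_layers (up ?\<sigma>) A rs \<longleftrightarrow> has_layers (\<lambda>a b. X a < X b \<and> Y a < Y b) (?\<phi> ` A) rs"
      if "A \<subseteq> {..<N}" for A
    proof (rule has_layers_bij)
      show "bij_betw ?\<phi> A (?\<phi> ` A)"
        using bij that by (auto simp: bij_betw_def intro: inj_on_subset)
    qed (use that up in auto)
    have "bij_betw ((`) ?\<phi>) {A \<in> Pow {..<N}. has_layers (up ?\<sigma>) A rs}
       {A \<in> Pow {..<N}. has_layers (\<lambda>a b. X a < X b \<and> Y a < Y b) A rs}"
      (is "bij_betw _ ?P ?Q")
    proof (rule bij_betw_imageI)
      show "inj_on ((`) ?\<phi>) ?P"
        using bij_betw_Pow[OF bij] by (auto simp: bij_betw_def intro: inj_on_subset)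
      have im: "(`) ?\<phi> ` Pow {..<N} = Pow {..<N}" using bij_betw_Pow[OF bij] by (simp add: bij_betw_def)
      show "(`) ?\<phi> ` ?P = ?Q"
      proof (intro equalityI subsetI)
        fix B assume "B \<in> (`) ?\<phi> ` ?P"
        then show "B \<in> ?Q" using iff im by blast
      next
        fix B assume B: "B \<in> ?Q"
        then have "B \<in> (`) ?\<phi> ` Pow {..<N}" using im by simp
        then obtain A where A: "A \<in> Pow {..<N}" "B = ?\<phi> ` A" by (rule imageE)
        then have "A \<in> ?P" using iff[of A] B by simp
        then show "B \<in> (`) ?\<phi> ` ?P" using A(2) by (intro image_eqI)
      qed
    qed
    then show ?thesis by (simp add: bij_betw_same_card Pow_def)
  qed
  then show ?thesis using \<sigma> by blast
qed

section \<open>Quasi-block decompositions\<close>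

definition cut :: "nat list \<Rightarrow> nat \<Rightarrow> nat" where
  "cut rs i = sum_list (take i rs)"

text \<open>The block \<open>{s..<e}\<close> is a layer, respectively an antilayeroid.\<close>

definition layer_between :: "nat list \<Rightarrow> nat \<Rightarrow> nat \<Rightarrow> bool" where
  "layer_between rs s e \<longleftrightarrow> (\<exists>i<length rs. s = cut rs i \<and> e = cut rs (Suc i))"

definition units_between :: "nat list \<Rightarrow> nat \<Rightarrow> nat \<Rightarrow> bool" where
  "units_between rs s e \<longleftrightarrow> (\<exists>c d. unit_layers rs c d \<and> s = cut rs c \<and> e = cut rs d)"

definition valid_blocks :: "(nat \<times> nat) list \<Rightarrow> bool" where
  "valid_blocks q \<longleftrightarrow> (\<forall>(l, \<xi>)\<in>set q. l > 0 \<and> \<xi> \<in> {0, 1} \<and> (\<xi> = 0 \<longrightarrow> l \<ge> 2))"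

text \<open>The layer sizes that a block list describes. Read in this direction, the decompositions
  of a layered permutation form a fibre of one function, and words can be compared with it.\<close>

definition expand :: "(nat \<times> nat) list \<Rightarrow> nat list" where
  "expand q = concat (map (\<lambda>(l, \<xi>). if \<xi> = 0 then [l] else replicate l 1) q)"

lemma cut_0 [simp]: "cut rs 0 = 0" by (simp add: cut_def)

lemma cut_Suc: "i < length rs \<Longrightarrow> cut rs (Suc i) = cut rs i + rs ! i"
  by (simp add: cut_def take_Suc_conv_app_nth)

lemma cut_Cons_Suc [simp]: "cut (l # ls) (Suc i) = l + cut ls i"
  by (simp add: cut_def)

lemma cut_append: "cut (ps @ rs) (length ps + i) = sum_list ps + cut rs i"
  by (simp add: cut_def)

lemma cut_pos_less:
  assumes "0 \<notin> set rs" "i < j" "j \<le> length rs"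
  shows "cut rs i < cut rs j"
  using assms(2,3)
proof (induction j)
  case (Suc j)
  then have "rs ! j > 0" using assms(1) by (metis Suc_le_lessD bot_nat_0.not_eq_extremum nth_mem)
  then have "cut rs j < cut rs (Suc j)" using Suc by (simp add: cut_Suc)
  moreover have "cut rs i \<le> cut rs j" using Suc by (cases "i = j") auto
  ultimately show ?case by linarith
qed simp

lemma cut_inj: "0 \<notin> set rs \<Longrightarrow> i \<le> length rs \<Longrightarrow> j \<le> length rs \<Longrightarrow> cut rs i = cut rs j \<Longrightarrow> i = j"
  using cut_pos_less[of rs i j] cut_pos_less[of rs j i] by (cases i j rule: linorder_cases) auto

lemma block_eq_cut: "i < length rs \<Longrightarrow> block rs i = {cut rs i..<cut rs (Suc i)}"
  by (simp add: block_def cut_def take_Suc_conv_app_nth)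

lemma cut_mono: "i \<le> j \<Longrightarrow> cut rs i \<le> cut rs j"
  unfolding cut_def by (metis le_add1 le_add_diff_inverse sum_list_append take_add)

lemma UN_block_eq_cut: "c \<le> d \<Longrightarrow> d \<le> length rs \<Longrightarrow> (\<Union>i\<in>{c..<d}. block rs i) = {cut rs c..<cut rs d}"
proof (induction d)
  case (Suc d)
  show ?case
  proof (cases "c = Suc d")
    case False
    then have "c \<le> d" using Suc.prems by simp
    then show ?thesis
      using Suc cut_mono[of c d rs] cut_mono[of d "Suc d" rs]
      by (simp add: atLeastLessThanSuc block_eq_cut Un_commute ivl_disj_un_two(3))
  qed simp
qed simp

text \<open>Cuts increase strictly over positive entries, so a cut at or beyond the end of
  \<open>ps\<close> has used all of \<open>ps\<close>. This allows a prefix of layers to be split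
  off.\<close>

lemma cut_append_ge:
  assumes "0 \<notin> set ps" "cut (ps @ rs) i = sum_list ps + s"
  shows "length ps \<le> i"
proof (rule ccontr)
  assume "\<not> length ps \<le> i"
  then have "cut (ps @ rs) i = cut ps i" "i < length ps" by (simp_all add: cut_def)
  moreover have "cut ps i < cut ps (length ps)"
    using assms(1) \<open>i < length ps\<close> by (intro cut_pos_less) auto
  ultimately show False using assms(2) by (simp add: cut_def)
qed

lemma layer_between_append:
  assumes "0 \<notin> set ps"
  shows "layer_between (ps @ rs) (sum_list ps + s) (sum_list ps + e) \<longleftrightarrow> layer_between rs s e"
proof
  assume "layer_between (ps @ rs) (sum_list ps + s) (sum_list ps + e)"
  then obtain i where i: "i < length (ps @ rs)" "cut (ps @ rs) i = sum_list ps + s"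
    "cut (ps @ rs) (Suc i) = sum_list ps + e"
    unfolding layer_between_def by metis
  then obtain j where j: "i = length ps + j" using cut_append_ge[OF assms i(2)] le_Suc_ex by blast
  then show "layer_between rs s e"
    using i cut_append[of ps rs j] cut_append[of ps rs "Suc j"] by (auto simp: layer_between_def)
next
  assume "layer_between rs s e"
  then obtain i where "i < length rs" "s = cut rs i" "e = cut rs (Suc i)"
    unfolding layer_between_def by blast
  then show "layer_between (ps @ rs) (sum_list ps + s) (sum_list ps + e)"
    using cut_append[of ps rs i] cut_append[of ps rs "Suc i"] unfolding layer_between_def
    by (intro exI[of _ "length ps + i"]) auto
qed

lemma units_between_append:
  assumes "0 \<notin> set ps"
  shows "units_between (ps @ rs) (sum_list ps + s) (sum_list ps + e) \<longleftrightarrow> units_between rs s e"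
proof
  assume "units_between (ps @ rs) (sum_list ps + s) (sum_list ps + e)"
  then obtain c d where cd: "unit_layers (ps @ rs) c d" "cut (ps @ rs) c = sum_list ps + s"
    "cut (ps @ rs) d = sum_list ps + e"
    unfolding units_between_def by metis
  obtain c' where c: "c = length ps + c'" using cut_append_ge[OF assms cd(2)] le_Suc_ex by blast
  obtain d' where d: "d = length ps + d'" using cut_append_ge[OF assms cd(3)] le_Suc_ex by blast
  have "rs ! i = 1" if "i \<in> {c'..<d'}" for i
  proof -
    have "length ps + i \<in> {c..<d}" using that c d by simp
    then have "(ps @ rs) ! (length ps + i) = 1" using cd(1) unfolding unit_layers_def by blast
    then show ?thesis by simp
  qed
  then have "unit_layers rs c' d'" using cd(1) c d by (auto simp: unit_layers_def)
  moreover have "s = cut rs c'" "e = cut rs d'"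
    using cd c d cut_append[of ps rs c'] cut_append[of ps rs d'] by auto
  ultimately show "units_between rs s e" unfolding units_between_def by blast
next
  assume "units_between rs s e"
  then obtain c d where cd: "unit_layers rs c d" "s = cut rs c" "e = cut rs d"
    unfolding units_between_def by blast
  have "(ps @ rs) ! i = 1" if i: "i \<in> {length ps + c..<length ps + d}" for i
  proof -
    obtain j where j: "i = length ps + j" using i le_Suc_ex[of "length ps" i] by auto
    then have "j \<in> {c..<d}" using i by simp
    then have "rs ! j = 1" using cd(1) unfolding unit_layers_def by blast
    then show ?thesis using j by simp
  qed
  then have "unit_layers (ps @ rs) (length ps + c) (length ps + d)"
    using cd(1) by (simp add: unit_layers_def)
  then show "units_between (ps @ rs) (sum_list ps + s) (sum_list ps + e)"
    using cd cut_append[of ps rs c] cut_append[of ps rs d] unfolding units_between_def by metis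
qed

lemma expand_Nil [simp]: "expand [] = []" by (simp add: expand_def)

lemma expand_Cons [simp]: "expand ((l, \<xi>) # q) = (if \<xi> = 0 then [l] else replicate l 1) @ expand q"
  by (simp add: expand_def)

lemma valid_blocks_Cons [simp]:
  "valid_blocks ((l, \<xi>) # q) \<longleftrightarrow> l > 0 \<and> \<xi> \<in> {0, 1} \<and> (\<xi> = 0 \<longrightarrow> l \<ge> 2) \<and> valid_blocks q"
  by (simp add: valid_blocks_def)

lemma expand_pos: "valid_blocks q \<Longrightarrow> 0 \<notin> set (expand q)"
  by (induction q) (auto split: if_splits)

lemma sum_list_expand: "sum_list (expand q) = sum_list (map fst q)"
  by (induction q) (auto simp: sum_list_replicate)

text \<open>By induction on q: the first block starts at position 0, so its condition forces
  \<open>rs\<close> to begin with exactly the layers of this block. Deleting them shifts the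
  remaining conditions to the rest.\<close>

lemma expand_iff_blocks:
  assumes "0 \<notin> set rs" "valid_blocks q"
  shows "rs = expand q \<longleftrightarrow> sum_list (map fst q) = sum_list rs \<and>
    (\<forall>i<length q.
      (snd (q ! i) = 0 \<longrightarrow> layer_between rs (cut (map fst q) i) (cut (map fst q) (Suc i))) \<and>
      (snd (q ! i) = 1 \<longrightarrow> units_between rs (cut (map fst q) i) (cut (map fst q) (Suc i))))"
    (is "_ \<longleftrightarrow> _ \<and> ?B q rs")
  using assms
proof (induction q arbitrary: rs)
  case Nil
  then show ?case by (cases rs) auto
next
  case (Cons b q)
  obtain l \<xi> where b: "b = (l, \<xi>)" by (cases b)
  define ps where "ps = (if \<xi> = 0 then [l] else replicate l (1::nat))"
  have v: "l > 0" "\<xi> \<in> {0, 1}" "\<xi> = 0 \<longrightarrow> l \<ge> 2" "valid_blocks q" using Cons.prems b by auto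
  have ps: "sum_list ps = l" "0 \<notin> set ps" using v by (auto simp: ps_def sum_list_replicate)
  \<comment> \<open>Since \<open>rs\<close> has no zero entry, only the cut with index 0 lies at
    position 0.\<close>
  have first: "\<exists>rs'. rs = ps @ rs'" if "?B (b # q) rs"
  proof (cases "\<xi> = 0")
    case True
    then have "layer_between rs 0 l" using that b by (auto dest: spec[of _ 0])
    then obtain i where i: "i < length rs" "cut rs i = cut rs 0" "l = cut rs (Suc i)"
      unfolding layer_between_def by auto
    then have "i = 0" using cut_inj[OF Cons.prems(1), of i 0] by simp
    then have "rs = [l] @ tl rs" using i by (cases rs) auto
    then show ?thesis using True unfolding ps_def by metis
  next
    case False
    then have "\<xi> = 1" using v by simp
    then have "units_between rs 0 l" using that b by (auto dest: spec[of _ 0])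
    then obtain c d where cd: "unit_layers rs c d" "cut rs c = cut rs 0" "l = cut rs d"
      unfolding units_between_def by auto
    then have "c = 0" using cut_inj[OF Cons.prems(1), of c 0] by (simp add: unit_layers_def)
    then have t: "take d rs = replicate d 1"
      using cd(1) by (intro nth_equalityI) (auto simp: unit_layers_def)
    then have "l = d" using cd(3) by (simp add: cut_def sum_list_replicate)
    then have "rs = ps @ drop d rs" using t False unfolding ps_def by (metis append_take_drop_id)
    then show ?thesis by blast
  qed
  \<comment> \<open>The first condition holds by the form of \<open>rs\<close>, and the others move
    by the length l of the deleted prefix.\<close>
  have step: "?B (b # q) rs \<longleftrightarrow> ?B q rs'" if rs: "rs = ps @ rs'" for rs'
  proof -
    have 0: "\<xi> = 0 \<longrightarrow> layer_between rs 0 l"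
      using rs ps unfolding layer_between_def by (intro impI exI[of _ 0]) (auto simp: ps_def)
    have 1: "\<xi> = 1 \<longrightarrow> units_between rs 0 l"
      using rs ps v unfolding units_between_def
      by (intro impI exI[of _ 0] exI[of _ l]) (auto simp: ps_def unit_layers_def cut_def nth_append sum_list_replicate)
    show ?thesis
      using layer_between_append[OF ps(2), of rs'] units_between_append[OF ps(2), of rs'] 0 1
      unfolding rs[symmetric] ps(1) by (simp add: b All_less_Suc2 del: One_nat_def)
  qed
  show ?case
  proof
    assume "rs = expand (b # q)"
    then have rs: "rs = ps @ expand q" by (simp add: b ps_def)
    have "?B q (expand q)" using Cons.IH[of "expand q"] v expand_pos by blast
    then show "sum_list (map fst (b # q)) = sum_list rs \<and> ?B (b # q) rs"
      using step[OF rs] ps rs by (simp add: b sum_list_expand)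
  next
    assume *: "sum_list (map fst (b # q)) = sum_list rs \<and> ?B (b # q) rs"
    then obtain rs' where rs: "rs = ps @ rs'" using first by blast
    then have "?B q rs'" using step * by blast
    moreover have "sum_list (map fst q) = sum_list rs'" using * rs ps b by simp
    moreover have "0 \<notin> set rs'" using rs Cons.prems by simp
    ultimately have "rs' = expand q" using Cons.IH v by blast
    then show "rs = expand (b # q)" using rs by (simp add: b ps_def)
  qed
qed

text \<open>Among the ranges of unit layers that contain the given one, a longest is maximal under
  inclusion, that is, an antilayer.\<close>

lemma antilayeroid_iff: "antilayeroid rs c d \<longleftrightarrow> unit_layers rs c d"
proof
  assume "antilayeroid rs c d"
  then show "unit_layers rs c d"
    unfolding antilayeroid_def antilayer_def unit_layers_def by fastforce
next
  assume cd: "unit_layers rs c d"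
  let ?P = "\<lambda>(a, b). unit_layers rs a b \<and> a \<le> c \<and> d \<le> b"
  have "\<forall>p. ?P p \<longrightarrow> snd p - fst p < Suc (length rs)" by (auto simp: unit_layers_def)
  then obtain p where "?P p" "\<And>p'. ?P p' \<Longrightarrow> snd p' - fst p' \<le> snd p - fst p"
    using ex_has_greatest_nat[of ?P "(c, d)" "\<lambda>p. snd p - fst p" "Suc (length rs)"] cd by auto
  then obtain a b where ab: "unit_layers rs a b" "a \<le> c" "d \<le> b"
    and max: "\<And>a' b'. unit_layers rs a' b' \<Longrightarrow> a' \<le> c \<Longrightarrow> d \<le> b' \<Longrightarrow> b' - a' \<le> b - a"
    by (cases p) fastforce
  have "antilayer rs a b"
    unfolding antilayer_def
  proof (intro conjI allI impI ab(1))
    fix a' b' assume *: "unit_layers rs a' b' \<and> a' \<le> a \<and> b \<le> b'"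
    then have "b' - a' \<le> b - a" using ab by (intro max) auto
    moreover have "a < b" using ab(1) by (simp add: unit_layers_def)
    ultimately show "a' = a" "b' = b" using * by linarith+
  qed
  then show "antilayeroid rs c d"
    using ab cd unfolding antilayeroid_def by (auto simp: unit_layers_def)
qed

lemma layer_sequence_eq: "layer_sequence \<tau> rs \<Longrightarrow> layer_sequence \<tau> rs' \<longleftrightarrow> rs' = rs"
  using layer_sequence_unique by blast

lemma is_layer_iff:
  assumes "layer_sequence \<tau> rs" "s < e"
  shows "is_layer \<tau> {s..<e} \<longleftrightarrow> layer_between rs s e"
proof -
  have "is_layer \<tau> {s..<e} \<longleftrightarrow> (\<exists>i<length rs. {s..<e} = block rs i)"
    unfolding is_layer_def layer_sequence_eq[OF assms(1)] by simp
  also have "\<dots> \<longleftrightarrow> layer_between rs s e"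
    unfolding layer_between_def using assms(2) by (auto simp: block_eq_cut Ico_eq_Ico)
  finally show ?thesis .
qed

lemma is_antilayeroid_iff:
  assumes "layer_sequence \<tau> rs" "s < e"
  shows "is_antilayeroid \<tau> {s..<e} \<longleftrightarrow> units_between rs s e"
proof -
  have "is_antilayeroid \<tau> {s..<e} \<longleftrightarrow> (\<exists>c d. unit_layers rs c d \<and> {s..<e} = (\<Union>i\<in>{c..<d}. block rs i))"
    unfolding is_antilayeroid_def antilayeroid_iff layer_sequence_eq[OF assms(1)] by simp
  also have "\<dots> \<longleftrightarrow> (\<exists>c d. unit_layers rs c d \<and> {s..<e} = {cut rs c..<cut rs d})"
    by (intro ex_cong1 conj_cong refl) (simp add: UN_block_eq_cut unit_layers_def)
  also have "\<dots> \<longleftrightarrow> units_between rs s e"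
    unfolding units_between_def using assms(2) by (auto simp: Ico_eq_Ico)
  finally show ?thesis .
qed

lemma quasi_block_decomps_iff:
  assumes \<tau>: "layer_sequence \<tau> rs"
  shows "q \<in> quasi_block_decomps \<tau> \<longleftrightarrow> valid_blocks q \<and> rs = expand q"
proof -
  have pos: "fst (q ! i) > 0" if "valid_blocks q" "i < length q" for i
    using that unfolding valid_blocks_def case_prod_beta by simp
  have blk: "block (map fst q) i = {cut (map fst q) i..<cut (map fst q) (Suc i)}"
    "cut (map fst q) i < cut (map fst q) (Suc i)"
    if "valid_blocks q" "i < length q" for i
    using that pos[OF that] by (simp_all add: block_eq_cut cut_Suc)
  have v: "valid_blocks q \<longleftrightarrow> (\<forall>(l, \<xi>)\<in>set q. l > 0 \<and> \<xi> \<in> {0, 1})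
      \<and> (\<forall>i<length q. snd (q ! i) = 0 \<longrightarrow> fst (q ! i) \<ge> 2)"
    unfolding valid_blocks_def case_prod_beta all_set_conv_all_nth by blast
  have "q \<in> quasi_block_decomps \<tau> \<longleftrightarrow> valid_blocks q \<and> sum_list (map fst q) = length \<tau> \<and>
     (\<forall>i<length q. (snd (q ! i) = 0 \<longrightarrow> is_layer \<tau> (block (map fst q) i)) \<and>
        (snd (q ! i) = 1 \<longrightarrow> is_antilayeroid \<tau> (block (map fst q) i)))"
    unfolding quasi_block_decomps_def v by blast
  also have "\<dots> \<longleftrightarrow> valid_blocks q \<and> sum_list (map fst q) = sum_list rs \<and>
    (\<forall>i<length q.
      (snd (q ! i) = 0 \<longrightarrow> layer_between rs (cut (map fst q) i) (cut (map fst q) (Suc i))) \<and>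
      (snd (q ! i) = 1 \<longrightarrow> units_between rs (cut (map fst q) i) (cut (map fst q) (Suc i))))"
    using blk is_layer_iff[OF \<tau>] is_antilayeroid_iff[OF \<tau>] layer_sequence_sum_list[OF \<tau>]
    by auto
  also have "\<dots> \<longleftrightarrow> valid_blocks q \<and> rs = expand q"
    using expand_iff_blocks[OF layer_sequenceD(2)[OF \<tau>]] by blast
  finally show ?thesis .
qed

lemma finite_quasi_block_decomps: "finite (quasi_block_decomps \<tau>)"
proof (rule finite_subset)
  let ?S = "{..length \<tau>} \<times> {0, 1 :: nat}"
  show "quasi_block_decomps \<tau> \<subseteq> {q. set q \<subseteq> ?S \<and> length q \<le> length \<tau>}"
  proof
    fix q assume q: "q \<in> quasi_block_decomps \<tau>"
    then have pos: "\<forall>l\<in>set (map fst q). l \<ge> 1" and sum: "sum_list (map fst q) = length \<tau>"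
      by (auto simp: quasi_block_decomps_def)
    have "length ls \<le> sum_list ls" if "\<forall>l\<in>set ls. l \<ge> 1" for ls :: "nat list"
      using that by (induction ls) auto
    then have "length (map fst q) \<le> sum_list (map fst q)" using pos .
    moreover have "l \<le> length \<tau>" if "(l, \<xi>) \<in> set q" for l \<xi>
      using that sum member_le_sum_list[of l "map fst q"] by force
    ultimately show "q \<in> {q. set q \<subseteq> ?S \<and> length q \<le> length \<tau>}"
      using q sum by (auto simp: quasi_block_decomps_def)
  qed
  show "finite {q. set q \<subseteq> ?S \<and> length q \<le> length \<tau>}"
    by (rule finite_lists_length_le) auto
qed

section \<open>The price polynomial as a sum over words\<close>

text \<open>The relation that a layered permutation induces on points that are distributed among
  consecutive blocks: the block \<open>i\<close> is increasing if \<open>i\<close> is odd and decreasing if \<open>i\<close> is even.\<close>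

definition word_less :: "(nat \<Rightarrow> nat) \<Rightarrow> nat \<Rightarrow> nat \<Rightarrow> bool" where
  "word_less w a b \<longleftrightarrow> w a < w b \<or> (w a = w b \<and> odd (w a) \<and> a < b)"

text \<open>For a probability vector x on the alphabet K: the probability that independent random
  letters at the positions in S produce an order with layer sizes \<open>rs\<close>.\<close>

definition word_sum :: "nat set \<Rightarrow> nat set \<Rightarrow> nat list \<Rightarrow> (nat \<Rightarrow> real) \<Rightarrow> real" where
  "word_sum S K rs x =
     (\<Sum>w\<in>S \<rightarrow>\<^sub>E K. (\<Prod>p\<in>S. x (w p)) * of_bool (has_layers (word_less w) S rs))"

text \<open>A letter used once is given kind 1 whatever its parity. This matches the condition that
  a block of kind 0 has length at least 2, and the clause l = 1 in the price polynomial.\<close>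

definition blocks_of :: "nat set \<Rightarrow> (nat \<Rightarrow> nat) \<Rightarrow> nat list \<Rightarrow> (nat \<times> nat) list" where
  "blocks_of S w is = map (\<lambda>i. let c = card {p \<in> S. w p = i} in (c, if c = 1 then 1 else i mod 2)) is"

lemma valid_blocks_of:
  assumes "finite S" "set is \<subseteq> w ` S"
  shows "valid_blocks (blocks_of S w is)"
proof -
  have "card {p \<in> S. w p = i} > 0" if "i \<in> set is" for i
    using that assms by (auto simp: card_gt_0_iff)
  then have "card {p \<in> S. w p = i} = Suc 0 \<or> card {p \<in> S. w p = i} \<ge> 2" if "i \<in> set is" for i
    using that by (metis Suc_leI le_neq_implies_less numeral_2_eq_2)
  then show ?thesis by (force simp: valid_blocks_def blocks_of_def Let_def)
qed

text \<open>Points with the least letter lie below all others. They form a chain if the letter is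
  odd and an antichain if it is even, and for a single point the two readings coincide.\<close>

lemma has_layers_blocks_of:
  assumes "finite S" "sorted_wrt (<) is"
  shows "has_layers (word_less w) {p \<in> S. w p \<in> set is} (expand (blocks_of S w is))"
  using assms(2)
proof (induction "is")
  case Nil
  then show ?case by (simp add: blocks_of_def has_layers_def)
next
  case (Cons i "is")
  let ?A = "{p \<in> S. w p = i}" and ?B = "{p \<in> S. w p \<in> set is}"
  let ?c = "card ?A"
  let ?r = "if (if ?c = 1 then 1 else i mod 2) = 0 then [?c] else replicate ?c 1"
  have fin: "finite ?A" using assms(1) by simp
  have "has_layers (word_less w) ?A ?r"
  proof (cases "odd i")
    case True
    then have "has_layers (word_less w) ?A (replicate ?c 1)"
      using fin by (intro has_layers_replicate) (auto simp: word_less_def)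
    then show ?thesis using True by (simp add: odd_iff_mod_2_eq_one)
  next
    case False
    then have "has_layers (word_less w) ?A [?c]"
      by (intro has_layers_single) (auto simp: word_less_def)
    then show ?thesis using False by (auto simp: even_iff_mod_2_eq_zero)
  qed
  moreover have "has_layers (word_less w) ?B (expand (blocks_of S w is))" using Cons by simp
  ultimately have "has_layers (word_less w) (?A \<union> ?B) (?r @ expand (blocks_of S w is))"
    using Cons.prems by (intro has_layers_append) (auto simp: word_less_def)
  moreover have "?A \<union> ?B = {p \<in> S. w p \<in> set (i # is)}" by auto
  ultimately show ?case by (simp add: blocks_of_def Let_def)
qed

definition word_blocks :: "nat set \<Rightarrow> (nat \<Rightarrow> nat) \<Rightarrow> (nat \<times> nat) list" where
  "word_blocks S w = blocks_of S w (sorted_list_of_set (w ` S))"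

text \<open>The block list of a word always expands to the layer sizes of the word, which are
  unique. So the words counted in \<open>word_sum\<close> are those whose block list is a
  decomposition of \<tau>.\<close>

lemma has_layers_word_iff:
  assumes \<tau>: "layer_sequence \<tau> rs" and fin: "finite S"
  shows "has_layers (word_less w) S rs \<longleftrightarrow> word_blocks S w \<in> quasi_block_decomps \<tau>"
proof -
  have v: "valid_blocks (word_blocks S w)"
    unfolding word_blocks_def using fin by (intro valid_blocks_of) auto
  have "{p \<in> S. w p \<in> set (sorted_list_of_set (w ` S))} = S" using fin by auto
  then have "has_layers (word_less w) S (expand (word_blocks S w))"
    using has_layers_blocks_of[OF fin, of "sorted_list_of_set (w ` S)" w] by (simp add: word_blocks_def)
  then have "has_layers (word_less w) S rs \<longleftrightarrow> rs = expand (word_blocks S w)"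
    using has_layers_unique[of "word_less w" S rs "expand (word_blocks S w)"]
      layer_sequenceD(2)[OF \<tau>] expand_pos[OF v] by auto
  then show ?thesis using quasi_block_decomps_iff[OF \<tau>] v by simp
qed

text \<open>Listing the values of a word identifies the words of content M with the arrangements of
  M, whose number is a multinomial coefficient.\<close>

lemma card_words_with_content:
  "card {w \<in> {..<m} \<rightarrow>\<^sub>E K. image_mset w (mset_set {..<m}) = M} =
     (if set_mset M \<subseteq> K \<and> size M = m then card (permutations_of_multiset M) else 0)"
proof (cases "set_mset M \<subseteq> K \<and> size M = m")
  case True
  let ?W = "{w \<in> {..<m} \<rightarrow>\<^sub>E K. image_mset w (mset_set {..<m}) = M}"
  have ms: "mset (map w [0..<m]) = image_mset w (mset_set {..<m})" for w :: "nat \<Rightarrow> 'a"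
    by (simp add: atLeast0LessThan)
  have "bij_betw (\<lambda>w. map w [0..<m]) ?W (permutations_of_multiset M)"
  proof (rule bij_betw_imageI)
    show "inj_on (\<lambda>w. map w [0..<m]) ?W"
    proof (rule inj_onI)
      fix w w' assume *: "w \<in> ?W" "w' \<in> ?W" and eq: "map w [0..<m] = map w' [0..<m]"
      have "w p = w' p" if "p \<in> {..<m}" for p
        using eq that unfolding map_eq_conv by simp
      then show "w = w'" using * by (intro PiE_ext[of w "{..<m}" "\<lambda>_. K" w']) auto
    qed
    show "(\<lambda>w. map w [0..<m]) ` ?W = permutations_of_multiset M"
    proof (intro equalityI subsetI)
      fix xs assume "xs \<in> (\<lambda>w. map w [0..<m]) ` ?W"
      then obtain w where w: "w \<in> ?W" "xs = map w [0..<m]" by (rule imageE)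
      then have "mset xs = M" using ms[of w] by simp
      then show "xs \<in> permutations_of_multiset M" by (simp add: permutations_of_multiset_def)
    next
      fix xs assume "xs \<in> permutations_of_multiset M"
      then have xs: "mset xs = M" by (simp add: permutations_of_multiset_def)
      then have len: "length xs = m" and set: "set xs \<subseteq> K" using True by auto
      let ?w = "\<lambda>j\<in>{..<m}. xs ! j"
      have m: "map ?w [0..<m] = xs" using len by (intro nth_equalityI) auto
      have "image_mset ?w (mset_set {..<m}) = M"
        using ms[of ?w] unfolding m xs by (rule sym)
      moreover have "xs ! j \<in> K" if "j < m" for j using set len that nth_mem by blast
      then have "?w \<in> {..<m} \<rightarrow>\<^sub>E K" by auto
      ultimately have "?w \<in> ?W" by blast
      then show "xs \<in> (\<lambda>w. map w [0..<m]) ` ?W" by (rule image_eqI[where x = ?w, rotated]) (rule m[symmetric])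
    qed
  qed
  then show ?thesis using True by (simp add: bij_betw_same_card)
next
  case False
  have "{w \<in> {..<m} \<rightarrow>\<^sub>E K. image_mset w (mset_set {..<m}) = M} = {}"
  proof (rule equals0I)
    fix w assume "w \<in> {w \<in> {..<m} \<rightarrow>\<^sub>E K. image_mset w (mset_set {..<m}) = M}"
    then have w: "w \<in> {..<m} \<rightarrow>\<^sub>E K" "M = image_mset w (mset_set {..<m})" by simp_all
    then have "set_mset M = w ` {..<m}" "size M = m" by simp_all
    then show False using False w(1) by auto
  qed
  then show ?thesis using False by (simp only: card.empty if_False)
qed

lemma prod_sorted_list_of_set:
  assumes "finite I"
  shows "(\<Prod>i\<in>I. F i) = (\<Prod>j<card I. F (sorted_list_of_set I ! j))"
  by (rule prod.reindex_bij_betw[symmetric], rule bij_betw_nth) (use assms in auto)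

text \<open>The summand of \<open>price_poly\<close> for one decomposition and one index set,
  without the factor m!.\<close>

definition block_term :: "(nat \<Rightarrow> real) \<Rightarrow> (nat \<times> nat) list \<Rightarrow> nat set \<Rightarrow> real" where
  "block_term x q I = (\<Prod>j<length q.
     let i = sorted_list_of_set I ! j; l = fst (q ! j); \<xi> = snd (q ! j)
     in x i ^ l / fact l * of_bool (i mod 2 = \<xi> \<or> l = 1))"

text \<open>Only multiplicities remain to be compared. A block of length 1 has kind 1 by validity,
  and the kind of every longer block is the parity of its letter by the hypothesis on I.\<close>

lemma word_blocks_eq_iff:
  assumes v: "valid_blocks q" and fin: "finite S" "finite I" and len: "card I = length q"
    and ind: "\<forall>j<length q. sorted_list_of_set I ! j mod 2 = snd (q ! j) \<or> fst (q ! j) = 1"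
  shows "word_blocks S w = q \<and> w ` S = I \<longleftrightarrow>
    image_mset w (mset_set S) = (\<Sum>j<length q. replicate_mset (fst (q ! j)) (sorted_list_of_set I ! j))"
    (is "_ \<longleftrightarrow> _ = ?M")
proof -
  let ?s = "sorted_list_of_set I"
  have s: "distinct ?s" "set ?s = I" "length ?s = length q" using fin len by auto
  have cM: "count ?M (?s ! j) = fst (q ! j)" if "j < length q" for j
  proof -
    have "count ?M (?s ! j) = (\<Sum>k<length q. if k = j then fst (q ! k) else 0)"
      unfolding count_sum using s that by (intro sum.cong) (auto simp: nth_eq_iff_index_eq)
    then show ?thesis using that by simp
  qed
  have cM0: "count ?M i = 0" if "i \<notin> I" for i
    unfolding count_sum using s that nth_mem by (intro sum.neutral) force
  have qpos: "fst (q ! j) > 0" and q0: "snd (q ! j) = 0 \<Longrightarrow> fst (q ! j) \<ge> 2"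
    and q01: "snd (q ! j) = 0 \<or> snd (q ! j) = 1" if "j < length q" for j
    using v nth_mem[OF that] unfolding valid_blocks_def case_prod_beta by auto
  have cw: "count (image_mset w (mset_set S)) i = card {p \<in> S. w p = i}" for i
  proof -
    have "(\<Sum>p | p \<in> S \<and> i = w p. count (mset_set S) p) = (\<Sum>p\<in>{p \<in> S. w p = i}. 1)"
      using fin by (intro sum.cong) auto
    then show ?thesis using fin by (simp add: count_image_mset')
  qed
  show ?thesis
  proof
    assume *: "word_blocks S w = q \<and> w ` S = I"
    show "image_mset w (mset_set S) = ?M"
    proof (rule multiset_eqI)
      fix i
      show "count (image_mset w (mset_set S)) i = count ?M i"
      proof (cases "i \<in> I")
        case True
        then obtain j where j: "j < length q" "i = ?s ! j" using s by (metis in_set_conv_nth)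
        have "q = blocks_of S w ?s" using * by (auto simp: word_blocks_def)
        then have "fst (q ! j) = card {p \<in> S. w p = i}"
          using j s by (simp add: blocks_of_def Let_def)
        then show ?thesis using cM j cw by simp
      next
        case False
        then have "{p \<in> S. w p = i} = {}" using * by auto
        then have "card {p \<in> S. w p = i} = 0" by (simp only: card.empty)
        then show ?thesis using cM0[OF False] cw by simp
      qed
    qed
  next
    assume *: "image_mset w (mset_set S) = ?M"
    have "w ` S = set_mset ?M" using fin by (simp flip: *)
    also have "\<dots> = I"
    proof (intro equalityI subsetI)
      fix i assume "i \<in># ?M"
      then show "i \<in> I" using cM0[of i] by (metis count_eq_zero_iff)
    next
      fix i assume "i \<in> I"
      then obtain j where j: "j < length q" "i = ?s ! j" using s by (metis in_set_conv_nth)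
      then have "count ?M i > 0" using cM[OF j(1)] qpos[OF j(1)] by (simp only:)
      then show "i \<in># ?M" by (simp only: count_greater_zero_iff)
    qed
    finally have I: "w ` S = I" .
    have "blocks_of S w ?s = q"
    proof (rule nth_equalityI)
      fix j assume "j < length (blocks_of S w ?s)"
      then have j: "j < length q" using s by (simp add: blocks_of_def)
      let ?c = "card {p \<in> S. w p = ?s ! j}"
      have c: "?c = fst (q ! j)" using cM[OF j] cw * by metis
      have "(if ?c = 1 then 1 else ?s ! j mod 2) = snd (q ! j)"
        using c q0[OF j] q01[OF j] ind j by auto
      then show "blocks_of S w ?s ! j = q ! j" using j s c by (simp add: blocks_of_def Let_def prod_eq_iff)
    qed (use s in \<open>simp add: blocks_of_def\<close>)
    then show "word_blocks S w = q \<and> w ` S = I" using I by (simp add: word_blocks_def)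
  qed
qed

text \<open>If the parities fit, the words in question are the arrangements of one multiset. All
  have the same product of variables, and their number is m! divided by the factorials of the block
  lengths.\<close>

lemma sum_words_with_blocks:
  assumes v: "valid_blocks q" and sum: "sum_list (map fst q) = m"
    and K: "finite K" "I \<subseteq> K" and len: "card I = length q"
  shows "(\<Sum>w\<in>{w \<in> {..<m} \<rightarrow>\<^sub>E K. word_blocks {..<m} w = q \<and> w ` {..<m} = I}. \<Prod>p<m. x (w p))
    = fact m * block_term x q I"
proof -
  let ?s = "sorted_list_of_set I"
  have fin: "finite I" using K finite_subset by blast
  have s: "distinct ?s" "set ?s = I" "length ?s = length q" using fin len by auto
  show ?thesis
  proof (cases "\<forall>j<length q. ?s ! j mod 2 = snd (q ! j) \<or> fst (q ! j) = 1")
    case False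
    then obtain j where j: "j < length q" "?s ! j mod 2 \<noteq> snd (q ! j)" "fst (q ! j) \<noteq> 1" by blast
    \<comment> \<open>If a block of length other than 1 meets a letter of the wrong parity, no word
      has these blocks, and an indicator in \<open>block_term\<close> vanishes as well.\<close>
    have "{w \<in> {..<m} \<rightarrow>\<^sub>E K. word_blocks {..<m} w = q \<and> w ` {..<m} = I} = {}"
    proof (intro equals0I)
      fix w assume "w \<in> {w \<in> {..<m} \<rightarrow>\<^sub>E K. word_blocks {..<m} w = q \<and> w ` {..<m} = I}"
      then have "q = blocks_of {..<m} w ?s" by (auto simp: word_blocks_def)
      then have "q ! j = blocks_of {..<m} w ?s ! j" by simp
      then show False using j s by (auto simp: blocks_of_def Let_def split: if_splits)
    qed
    moreover have "block_term x q I = 0"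
      unfolding block_term_def using j by (intro prod_zero) (auto simp: Let_def intro!: bexI[of _ j])
    ultimately show ?thesis by (simp only: sum.empty mult_zero_right)
  next
    case True
    define M where "M = (\<Sum>j<length q. replicate_mset (fst (q ! j)) (?s ! j))"
    have cM: "count M (?s ! j) = fst (q ! j)" if "j < length q" for j
    proof -
      have "count M (?s ! j) = (\<Sum>k<length q. if k = j then fst (q ! k) else 0)"
        unfolding M_def count_sum using s that by (intro sum.cong) (auto simp: nth_eq_iff_index_eq)
      then show ?thesis using that by simp
    qed
    have qpos: "fst (q ! j) > 0" if "j < length q" for j
      using v nth_mem[OF that] unfolding valid_blocks_def case_prod_beta by auto
    have cM0: "count M i = 0" if "i \<notin> I" for i
      unfolding M_def count_sum using s that nth_mem by (intro sum.neutral) force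
    have setM: "set_mset M = I"
    proof (intro equalityI subsetI)
      fix i assume "i \<in># M"
      then show "i \<in> I" using cM0[of i] by (metis count_eq_zero_iff)
    next
      fix i assume "i \<in> I"
      then obtain j where j: "j < length q" "i = ?s ! j" using s by (metis in_set_conv_nth)
      then have "count M i > 0" using cM[OF j(1)] qpos[OF j(1)] by (simp only:)
      then show "i \<in># M" by (simp only: count_greater_zero_iff)
    qed
    have sizeM: "size M = m"
      using sum_comp_morphism[of size "\<lambda>j. replicate_mset (fst (q ! j)) (?s ! j)" "{..<length q}"]
      unfolding M_def sum[symmetric] by (simp add: sum_list_sum_nth atLeast0LessThan)
    have fibre: "{w \<in> {..<m} \<rightarrow>\<^sub>E K. word_blocks {..<m} w = q \<and> w ` {..<m} = I}
      = {w \<in> {..<m} \<rightarrow>\<^sub>E K. image_mset w (mset_set {..<m}) = M}"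
      using word_blocks_eq_iff[OF v _ fin len True, of "{..<m}"] unfolding M_def by auto
    have prod: "(\<Prod>p<m. x (w p)) = (\<Prod>j<length q. x (?s ! j) ^ fst (q ! j))"
      if w: "image_mset w (mset_set {..<m}) = M" for w
    proof -
      have "(\<Prod>p<m. x (w p)) = (\<Prod>i\<in>#M. x i)"
        by (simp add: prod_unfold_prod_mset image_mset.compositionality comp_def flip: w)
      also have "\<dots> = (\<Prod>i\<in>I. x i ^ count M i)" by (simp add: image_prod_mset_multiplicity setM)
      also have "\<dots> = (\<Prod>j<length q. x (?s ! j) ^ fst (q ! j))"
        using cM by (simp add: prod_sorted_list_of_set[OF fin] len)
      finally show ?thesis .
    qed
    have "card (permutations_of_multiset M) * (\<Prod>i\<in>I. fact (count M i)) = (fact m :: nat)"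
      using card_permutations_of_multiset_aux[of M] setM sizeM by simp
    moreover have "(\<Prod>i\<in>I. fact (count M i)) = (\<Prod>j<length q. fact (fst (q ! j)) :: nat)"
      using cM by (simp add: prod_sorted_list_of_set[OF fin] len)
    ultimately have "real (card (permutations_of_multiset M)) * (\<Prod>j<length q. fact (fst (q ! j))) = fact m"
      by (metis (mono_tags, lifting) of_nat_fact of_nat_mult of_nat_prod prod.cong)
    then have card: "real (card (permutations_of_multiset M)) = fact m / (\<Prod>j<length q. fact (fst (q ! j)))"
      by (simp add: field_simps)
    have "block_term x q I = (\<Prod>j<length q. x (?s ! j) ^ fst (q ! j) / fact (fst (q ! j)))"
      unfolding block_term_def using True by (intro prod.cong) (auto simp: Let_def)
    then have bt: "block_term x q I = (\<Prod>j<length q. x (?s ! j) ^ fst (q ! j)) / (\<Prod>j<length q. fact (fst (q ! j)))"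
      by (simp add: prod_dividef)
    have "(\<Sum>w\<in>{w \<in> {..<m} \<rightarrow>\<^sub>E K. image_mset w (mset_set {..<m}) = M}. \<Prod>p<m. x (w p))
       = real (card (permutations_of_multiset M)) * (\<Prod>j<length q. x (?s ! j) ^ fst (q ! j))"
      using prod card_words_with_content[of m K M] setM sizeM K by simp
    then show ?thesis unfolding fibre bt card by simp
  qed
qed

text \<open>Grouping the words by block list and set of letters turns the sum over words into the
  double sum of the price polynomial.\<close>

lemma price_poly_eq_word_sum:
  assumes \<tau>: "layer_sequence \<tau> rs"
  shows "price_poly n \<tau> x = word_sum {..<length \<tau>} {1..2 * n} rs x"
proof -
  let ?m = "length \<tau>" and ?K = "{1..2 * n}" and ?Q = "quasi_block_decomps \<tau>"
  let ?W = "{w \<in> {..<?m} \<rightarrow>\<^sub>E ?K. word_blocks {..<?m} w \<in> ?Q}"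
  let ?T = "SIGMA q:?Q. {I. I \<subseteq> ?K \<and> card I = length q}"
  let ?g = "\<lambda>w. (word_blocks {..<?m} w, w ` {..<?m})"
  have finW: "finite ({..<?m} \<rightarrow>\<^sub>E ?K)" by (intro finite_PiE) auto
  have finT: "finite ?T" using finite_quasi_block_decomps by (intro finite_SigmaI) auto
  have "word_sum {..<?m} ?K rs x = (\<Sum>w\<in>{..<?m} \<rightarrow>\<^sub>E ?K. if word_blocks {..<?m} w \<in> ?Q then \<Prod>p<?m. x (w p) else 0)"
    unfolding word_sum_def by (intro sum.cong) (simp_all add: has_layers_word_iff[OF \<tau>])
  also have "\<dots> = (\<Sum>w\<in>?W. \<Prod>p<?m. x (w p))"
    using finW by (simp add: sum.inter_filter)
  also have "\<dots> = (\<Sum>t\<in>?T. \<Sum>w\<in>{w \<in> ?W. ?g w = t}. \<Prod>p<?m. x (w p))"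
  proof (rule sum.group[symmetric])
    show "?g ` ?W \<subseteq> ?T" by (auto simp: word_blocks_def blocks_of_def PiE_def)
  qed (use finW finT in auto)
  also have "\<dots> = (\<Sum>(q, I)\<in>?T. fact ?m * block_term x q I)"
  proof (rule sum.cong[OF refl], clarify)
    fix q I assume q: "q \<in> ?Q" and I: "I \<subseteq> ?K" "card I = length q"
    have "valid_blocks q" using q quasi_block_decomps_iff[OF \<tau>] by blast
    moreover have "sum_list (map fst q) = ?m" using q by (simp add: quasi_block_decomps_def)
    moreover have "{w \<in> ?W. ?g w = (q, I)} = {w \<in> {..<?m} \<rightarrow>\<^sub>E ?K. word_blocks {..<?m} w = q \<and> w ` {..<?m} = I}"
      using q by auto
    ultimately show "(\<Sum>w\<in>{w \<in> ?W. ?g w = (q, I)}. \<Prod>p<?m. x (w p)) = fact ?m * block_term x q I"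
      using sum_words_with_blocks[of q ?m ?K I x] I by simp
  qed
  also have "\<dots> = price_poly n \<tau> x"
    unfolding price_poly_def block_term_def
    using finite_quasi_block_decomps by (subst sum.Sigma[symmetric]) (auto simp: sum_distrib_left)
  finally show ?thesis by simp
qed

section \<open>Comparison with the packing density\<close>

text \<open>Summing out a position on which F does not depend leaves the factor \<Sum> x =
  1.\<close>

lemma sum_PiE_marginal:
  fixes x :: "'b \<Rightarrow> real"
  assumes "finite B" "finite A" "A \<inter> B = {}" and x: "(\<Sum>k\<in>K. x k) = 1"
    and F: "\<And>c c'. (\<And>p. p \<in> A \<Longrightarrow> c p = c' p) \<Longrightarrow> F c = F c'"
  shows "(\<Sum>c\<in>A \<union> B \<rightarrow>\<^sub>E K. (\<Prod>p\<in>A \<union> B. x (c p)) * F c) = (\<Sum>c\<in>A \<rightarrow>\<^sub>E K. (\<Prod>p\<in>A. x (c p)) * F c)"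
  using assms(1,3)
proof (induction B)
  case (insert b B)
  let ?S = "A \<union> B"
  have b: "b \<notin> ?S" "finite ?S" using insert assms(2) by auto
  have "(\<Sum>c\<in>insert b ?S \<rightarrow>\<^sub>E K. (\<Prod>p\<in>insert b ?S. x (c p)) * F c)
    = (\<Sum>(y, g)\<in>K \<times> (?S \<rightarrow>\<^sub>E K). (\<Prod>p\<in>insert b ?S. x ((g(b := y)) p)) * F (g(b := y)))"
    unfolding PiE_insert_eq using b(1)
    by (subst sum.reindex[OF inj_combinator]) (auto simp: case_prod_beta comp_def)
  also have "\<dots> = (\<Sum>(y, g)\<in>K \<times> (?S \<rightarrow>\<^sub>E K). x y * ((\<Prod>p\<in>?S. x (g p)) * F g))"
  proof (rule sum.cong[OF refl], clarify)
    fix y g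
    have "(\<Prod>p\<in>?S. x ((g(b := y)) p)) = (\<Prod>p\<in>?S. x (g p))"
      using b by (intro prod.cong) auto
    moreover have "F (g(b := y)) = F g" using insert.prems by (intro F) auto
    ultimately show "(\<Prod>p\<in>insert b ?S. x ((g(b := y)) p)) * F (g(b := y))
        = x y * ((\<Prod>p\<in>?S. x (g p)) * F g)"
      using b by (simp add: algebra_simps)
  qed
  also have "\<dots> = (\<Sum>y\<in>K. x y) * (\<Sum>g\<in>?S \<rightarrow>\<^sub>E K. (\<Prod>p\<in>?S. x (g p)) * F g)"
    by (simp add: sum_product sum.cartesian_product)
  also have "\<dots> = (\<Sum>g\<in>?S \<rightarrow>\<^sub>E K. (\<Prod>p\<in>?S. x (g p)) * F g)" by (simp add: x)
  finally show ?case using insert by (simp add: Un_insert_right)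
qed simp

text \<open>\<open>word_less\<close> sees positions only through their order, so the increasing
  enumeration of A carries one sum to the other.\<close>

lemma word_sum_card:
  assumes fin: "finite A"
  shows "word_sum A K rs x = word_sum {..<card A} K rs x"
proof -
  let ?s = "(!) (sorted_list_of_set A)" and ?m = "card A"
  have bij: "bij_betw ?s {..<?m} A" using fin by (intro bij_betw_nth) auto
  have less: "i < j \<longleftrightarrow> ?s i < ?s j" if "i < ?m" "j < ?m" for i j
    using that sorted_wrt_iff_nth_less[of "(<)" "sorted_list_of_set A"] strict_sorted_list_of_set[of A]
    by (metis length_sorted_list_of_set linorder_neqE_nat order_less_asym order_less_irrefl)
  let ?t = "the_inv_into {..<?m} ?s"
  have t: "?t (?s i) = i" if "i < ?m" for i
    using bij that by (intro the_inv_into_f_f) (auto simp: bij_betw_def)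
  have s: "?s (?t a) = a" "?t a < ?m" if "a \<in> A" for a
    using f_the_inv_into_f_bij_betw[OF bij that] bij_betw_the_inv_into[OF bij] that
    by (auto simp: bij_betw_def)
  have sA: "?s i \<in> A" if "i < ?m" for i using bij that by (auto simp: bij_betw_def)
  show ?thesis
    unfolding word_sum_def
  proof (rule sum.reindex_bij_witness[of _ "\<lambda>w. restrict (w \<circ> ?t) A" "\<lambda>c. restrict (c \<circ> ?s) {..<?m}"])
    fix c assume c: "c \<in> A \<rightarrow>\<^sub>E K"
    show "restrict (restrict (c \<circ> ?s) {..<?m} \<circ> ?t) A = c"
      using c s by (intro PiE_ext[OF _ c]) auto
    show "restrict (c \<circ> ?s) {..<?m} \<in> {..<?m} \<rightarrow>\<^sub>E K" using c sA by auto
    have "(\<Prod>p\<in>A. x (c p)) = (\<Prod>i<?m. x (c (?s i)))"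
      by (rule prod.reindex_bij_betw[OF bij, symmetric])
    moreover have "has_layers (word_less (restrict (c \<circ> ?s) {..<?m})) {..<?m} rs
        \<longleftrightarrow> has_layers (word_less c) A rs"
      using less by (intro has_layers_bij[OF bij]) (simp add: word_less_def)
    ultimately show "(\<Prod>p<?m. x (restrict (c \<circ> ?s) {..<?m} p))
        * of_bool (has_layers (word_less (restrict (c \<circ> ?s) {..<?m})) {..<?m} rs)
        = (\<Prod>p\<in>A. x (c p)) * of_bool (has_layers (word_less c) A rs)"
      by simp
  next
    fix w assume w: "w \<in> {..<?m} \<rightarrow>\<^sub>E K"
    show "restrict (w \<circ> ?t) A \<in> A \<rightarrow>\<^sub>E K" using w s by auto
    show "restrict (restrict (w \<circ> ?t) A \<circ> ?s) {..<?m} = w"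
      using w sA t by (intro PiE_ext[OF _ w]) auto
  qed
qed

text \<open>Linearity of expectation: a set A of the right size contributes the probability that its
  letters have layers \<open>rs\<close>, which depends on the size only. Sets of other sizes
  contribute 0.\<close>

lemma expected_occurrences:
  fixes x :: "nat \<Rightarrow> real"
  assumes x: "(\<Sum>k\<in>K. x k) = 1"
  shows "(\<Sum>c\<in>{..<N} \<rightarrow>\<^sub>E K. (\<Prod>p<N. x (c p)) * real (card {A. A \<subseteq> {..<N} \<and> has_layers (word_less c) A rs}))
    = real (N choose sum_list rs) * word_sum {..<sum_list rs} K rs x"
proof -
  let ?P = "\<lambda>c A. has_layers (word_less c) A rs"
  have count: "real (card {A. A \<subseteq> {..<N} \<and> ?P c A}) = (\<Sum>A\<in>Pow {..<N}. of_bool (?P c A))" for c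
    by (simp add: of_bool_def sum.If_cases Int_def Pow_def)
  have "(\<Sum>c\<in>{..<N} \<rightarrow>\<^sub>E K. (\<Prod>p<N. x (c p)) * real (card {A. A \<subseteq> {..<N} \<and> ?P c A}))
     = (\<Sum>A\<in>Pow {..<N}. \<Sum>c\<in>{..<N} \<rightarrow>\<^sub>E K. (\<Prod>p<N. x (c p)) * of_bool (?P c A))"
    unfolding count sum_distrib_left by (rule sum.swap)
  also have "\<dots> = (\<Sum>A\<in>Pow {..<N}. if card A = sum_list rs then word_sum {..<sum_list rs} K rs x else 0)"
  proof (rule sum.cong[OF refl])
    fix A assume "A \<in> Pow {..<N}"
    then have A: "A \<subseteq> {..<N}" "finite A" using finite_subset by auto
    have un: "A \<union> ({..<N} - A) = {..<N}" using A by auto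
    have "(\<Sum>c\<in>A \<union> ({..<N} - A) \<rightarrow>\<^sub>E K. (\<Prod>p\<in>A \<union> ({..<N} - A). x (c p)) * of_bool (?P c A))
        = (\<Sum>c\<in>A \<rightarrow>\<^sub>E K. (\<Prod>p\<in>A. x (c p)) * of_bool (?P c A))"
    proof (rule sum_PiE_marginal[OF _ A(2) _ x])
      fix c c' :: "nat \<Rightarrow> nat" assume "\<And>p. p \<in> A \<Longrightarrow> c p = c' p"
      then have "?P c A \<longleftrightarrow> ?P c' A" by (intro has_layers_cong) (simp add: word_less_def)
      then show "of_bool (?P c A) = (of_bool (?P c' A) :: real)" by simp
    qed auto
    then have eq: "(\<Sum>c\<in>{..<N} \<rightarrow>\<^sub>E K. (\<Prod>p<N. x (c p)) * of_bool (?P c A)) = word_sum A K rs x"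
      unfolding un word_sum_def .
    show "(\<Sum>c\<in>{..<N} \<rightarrow>\<^sub>E K. (\<Prod>p<N. x (c p)) * of_bool (?P c A))
      = (if card A = sum_list rs then word_sum {..<sum_list rs} K rs x else 0)"
    proof (cases "card A = sum_list rs")
      case True
      then show ?thesis unfolding eq using word_sum_card[OF A(2)] by simp
    next
      case False
      then have "\<not> ?P c A" for c using has_layers_card[of _ A rs] A(2) by blast
      then show ?thesis using False by simp
    qed
  qed
  also have "\<dots> = real (card {A \<in> Pow {..<N}. card A = sum_list rs}) * word_sum {..<sum_list rs} K rs x"
    by (simp add: sum.If_cases Int_def)
  also have "card {A \<in> Pow {..<N}. card A = sum_list rs} = N choose sum_list rs"
    using n_subsets[of "{..<N}" "sum_list rs"] by simp
  finally show ?thesis .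
qed

lemma exists_ge_average:
  fixes p v :: "'a \<Rightarrow> real"
  assumes "finite C" "\<And>c. c \<in> C \<Longrightarrow> p c \<ge> 0" "(\<Sum>c\<in>C. p c) = 1"
  shows "\<exists>c\<in>C. v c \<ge> (\<Sum>c\<in>C. p c * v c)"
proof (rule ccontr)
  let ?a = "\<Sum>c\<in>C. p c * v c"
  assume "\<not> (\<exists>c\<in>C. v c \<ge> ?a)"
  then have less: "v c < ?a" if "c \<in> C" for c using that by force
  \<comment> \<open>A point of positive mass makes the comparison of the averages strict.\<close>
  obtain c where c: "c \<in> C" "p c > 0"
  proof -
    have "\<exists>c\<in>C. p c \<noteq> 0" using assms(3) by (metis sum.neutral zero_neq_one)
    then show ?thesis using assms(2) that by force
  qed
  have "?a < (\<Sum>c\<in>C. p c * ?a)"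
  proof (rule sum_strict_mono_ex1[OF assms(1)])
    show "\<forall>c\<in>C. p c * v c \<le> p c * ?a"
      using less assms(2) by (intro ballI mult_left_mono) (auto intro: less_imp_le)
    show "\<exists>c\<in>C. p c * v c < p c * ?a"
      using c less by (intro bexI[of _ c] mult_strict_left_mono)
  qed
  then show False by (simp add: assms(3) flip: sum_distrib_right)
qed

text \<open>Point a is placed in the square of side N with number c a on the diagonal. Inside the
  square, points rise with a if the number is odd and fall if it is even.\<close>

lemma realize_word:
  "\<exists>\<sigma>\<in>perms N. \<forall>rs. card {A. A \<subseteq> {..<N} \<and> has_layers (up \<sigma>) A rs}
    = card {A. A \<subseteq> {..<N} \<and> has_layers (word_less c) A rs}"
proof -
  define X where "X a = c a * N + a" for a
  define Y where "Y a = c a * N + (if odd (c a) then a else N - 1 - a)" for a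
  \<comment> \<open>Offsets below N make numbers in base N compare lexicographically.\<close>
  have less: "u * N + d < v * N + e \<longleftrightarrow> u < v \<or> (u = v \<and> d < e)" if "d < N" "e < N" for u v d e :: nat
  proof (cases u v rule: linorder_cases)
    case less
    then have "Suc u * N \<le> v * N" by (intro mult_le_mono1) simp
    then show ?thesis using less that by simp
  next
    case greater
    then have "Suc v * N \<le> u * N" by (intro mult_le_mono1) simp
    then show ?thesis using greater that by simp
  qed simp
  have X: "X a < X b \<longleftrightarrow> c a < c b \<or> (c a = c b \<and> a < b)" if "a < N" "b < N" for a b
    unfolding X_def using that by (rule less)
  have Y: "Y a < Y b \<longleftrightarrow> c a < c b \<or> (c a = c b \<and> (if odd (c a) then a < b else b < a))" if "a < N" "b < N" for a b
    unfolding Y_def using that by (subst less) auto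
  have "inj_on X {..<N}"
    by (rule inj_onI) (metis X lessThan_iff linorder_neqE_nat order_less_irrefl)
  moreover have "inj_on Y {..<N}"
    by (rule inj_onI) (metis Y lessThan_iff linorder_neqE_nat order_less_irrefl)
  ultimately obtain \<sigma> where \<sigma>: "\<sigma> \<in> perms N" "\<forall>rs. card {A. A \<subseteq> {..<N} \<and> has_layers (up \<sigma>) A rs}
    = card {A. A \<subseteq> {..<N} \<and> has_layers (\<lambda>a b. X a < X b \<and> Y a < Y b) A rs}"
    using realize_plane_points by blast
  have "has_layers (\<lambda>a b. X a < X b \<and> Y a < Y b) A rs \<longleftrightarrow> has_layers (word_less c) A rs"
    if "A \<subseteq> {..<N}" for A rs
  proof (rule has_layers_cong)
    fix a b assume "a \<in> A" "b \<in> A"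
    then have ab: "a < N" "b < N" using that by auto
    show "X a < X b \<and> Y a < Y b \<longleftrightarrow> word_less c a b"
      unfolding X[OF ab] Y[OF ab] word_less_def by auto
  qed
  then have "{A. A \<subseteq> {..<N} \<and> has_layers (\<lambda>a b. X a < X b \<and> Y a < Y b) A rs}
      = {A. A \<subseteq> {..<N} \<and> has_layers (word_less c) A rs}" for rs by blast
  then show ?thesis using \<sigma> by auto
qed

definition max_density :: "perm_comb \<Rightarrow> nat \<Rightarrow> real" where
  "max_density f N = Max ((\<lambda>\<sigma>. linear_ext (\<lambda>\<tau>. pattern_density \<tau> \<sigma>) f) ` perms N)"

lemma max_density_ge:
  "\<sigma> \<in> perms N \<Longrightarrow> linear_ext (\<lambda>\<tau>. pattern_density \<tau> \<sigma>) f \<le> max_density f N"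
  unfolding max_density_def by (intro Max_ge) auto

lemma max_density_attained:
  "\<exists>\<sigma>\<in>perms N. max_density f N = linear_ext (\<lambda>\<tau>. pattern_density \<tau> \<sigma>) f"
proof -
  have "perms N \<noteq> {}" by simp
  then have "max_density f N \<in> (\<lambda>\<sigma>. linear_ext (\<lambda>\<tau>. pattern_density \<tau> \<sigma>) f) ` perms N"
    unfolding max_density_def by (intro Max_in) auto
  then show ?thesis by blast
qed

text \<open>With respect to the words \<open>c\<close> whose letters are chosen independently with probabilities \<open>x\<close>,
  the price polynomial is the expected density in the permutation determined by \<open>c\<close>.\<close>

lemma price_poly_le_max_density:
  assumes lay: "\<And>\<tau>. \<tau> \<in> Poly_Mapping.keys f \<Longrightarrow> layered \<tau>"
    and len: "\<And>\<tau>. \<tau> \<in> Poly_Mapping.keys f \<Longrightarrow> length \<tau> \<le> N"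
    and x: "x \<in> feasible n W"
  shows "price_poly_comb n f x \<le> max_density f N"
proof -
  let ?K = "{1..2 * n}" and ?F = "Poly_Mapping.keys f" and ?a = "Poly_Mapping.lookup f"
  obtain rs where rs: "\<And>\<tau>. \<tau> \<in> ?F \<Longrightarrow> layer_sequence \<tau> (rs \<tau>)"
    using lay unfolding layered_def by metis
  have x1: "(\<Sum>k\<in>?K. x k) = 1" and x0: "\<And>k. k \<in> ?K \<Longrightarrow> x k \<ge> 0"
    using x by (auto simp: feasible_def)
  let ?C = "{..<N} \<rightarrow>\<^sub>E ?K" and ?p = "\<lambda>c. \<Prod>i<N. x (c i)"
  let ?occ = "\<lambda>c \<tau>. real (card {A. A \<subseteq> {..<N} \<and> has_layers (word_less c) A (rs \<tau>)})"
  let ?v = "\<lambda>c. \<Sum>\<tau>\<in>?F. ?a \<tau> * (?occ c \<tau> / real (N choose length \<tau>))"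
  have "(\<Sum>c\<in>?C. ?p c * ?v c) = (\<Sum>\<tau>\<in>?F. ?a \<tau> / real (N choose length \<tau>) * (\<Sum>c\<in>?C. ?p c * ?occ c \<tau>))"
    unfolding sum_distrib_left by (subst sum.swap) (simp add: algebra_simps)
  also have "\<dots> = (\<Sum>\<tau>\<in>?F. ?a \<tau> * price_poly n \<tau> x)"
  proof (rule sum.cong[OF refl])
    fix \<tau> assume \<tau>: "\<tau> \<in> ?F"
    \<comment> \<open>With patterns no longer than N the binomial coefficient cancels, instead of
      producing a division by zero.\<close>
    have "N choose length \<tau> > 0" using len[OF \<tau>] by simp
    then show "?a \<tau> / real (N choose length \<tau>) * (\<Sum>c\<in>?C. ?p c * ?occ c \<tau>) = ?a \<tau> * price_poly n \<tau> x"
      unfolding expected_occurrences[OF x1] price_poly_eq_word_sum[OF rs[OF \<tau>]]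
        layer_sequence_sum_list[OF rs[OF \<tau>]] by simp
  qed
  also have "\<dots> = price_poly_comb n f x" by (simp add: price_poly_comb_def linear_ext_def)
  finally have avg: "(\<Sum>c\<in>?C. ?p c * ?v c) = price_poly_comb n f x" .
  have "(\<Sum>c\<in>?C. ?p c) = (\<Prod>i<N. \<Sum>k\<in>?K. x k)" by (subst prod_sum_PiE) auto
  then have "(\<Sum>c\<in>?C. ?p c) = 1" using x1 by simp
  moreover have "?p c \<ge> 0" if "c \<in> ?C" for c using that x0 by (intro prod_nonneg) (auto dest: PiE_mem)
  moreover have "finite ?C" by (intro finite_PiE) auto
  ultimately obtain c where c: "c \<in> ?C" "?v c \<ge> price_poly_comb n f x"
    using exists_ge_average[of ?C ?p ?v] avg by auto
  obtain \<sigma> where \<sigma>: "\<sigma> \<in> perms N" "\<forall>rs. card {A. A \<subseteq> {..<N} \<and> has_layers (up \<sigma>) A rs}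
    = card {A. A \<subseteq> {..<N} \<and> has_layers (word_less c) A rs}" using realize_word[of N c] by blast
  have "?v c = linear_ext (\<lambda>\<tau>. pattern_density \<tau> \<sigma>) f"
    unfolding linear_ext_def using \<sigma>(2) pattern_density_layered[OF rs \<sigma>(1)] by (intro sum.cong) auto
  then show ?thesis using c(2) max_density_ge[OF \<sigma>(1), of f] by simp
qed

section \<open>A value of the price polynomial close to the maximal density\<close>

text \<open>The word sum at the class proportions is the probability that m points drawn with
  replacement have layers \<open>rs\<close>. Keeping only the draws without repetition gives m!
  tuples for each occurrence, hence a lower bound.\<close>

lemma word_sum_ge_occurrences:
  assumes N: "N > 0" and K: "finite K" and c: "\<And>a. a < N \<Longrightarrow> c a \<in> K" "\<And>a. even (c a)"
  shows "word_sum {..<m} K rs (\<lambda>i. real (card {a. a < N \<and> c a = i}) / real N)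
    \<ge> fact m / real N ^ m * real (card {A. A \<subseteq> {..<N} \<and> card A = m \<and> has_layers (\<lambda>a b. c a < c b) A rs})"
proof -
  let ?V = "{..<N}" and ?R = "\<lambda>a b. c a < c b"
  let ?PV = "{..<m} \<rightarrow>\<^sub>E ?V" and ?PK = "{..<m} \<rightarrow>\<^sub>E K"
  let ?G = "\<lambda>p. has_layers (\<lambda>i j. c (p i) < c (p j)) {..<m} rs"
  \<comment> \<open>Each variable becomes a sum over points, so a product of variables expands into
    a sum over tuples of points.\<close>
  have x: "real (card {a. a < N \<and> c a = i}) / real N = (\<Sum>a<N. of_bool (c a = i) / real N)" for i
    by (simp add: of_bool_def sum.If_cases Int_def flip: sum_divide_distrib)
  have "word_sum {..<m} K rs (\<lambda>i. real (card {a. a < N \<and> c a = i}) / real N)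
    = (\<Sum>w\<in>?PK. (\<Sum>p\<in>?PV. \<Prod>j<m. of_bool (c (p j) = w j) / real N) * of_bool (has_layers (word_less w) {..<m} rs))"
    unfolding word_sum_def x by (subst prod_sum_PiE) auto
  also have "\<dots> = (\<Sum>p\<in>?PV. \<Sum>w\<in>?PK. (\<Prod>j<m. of_bool (c (p j) = w j) / real N) * of_bool (has_layers (word_less w) {..<m} rs))"
    unfolding sum_distrib_right by (rule sum.swap)
  \<comment> \<open>For a fixed tuple p the indicators leave only the word c \<circ> p. All its
    letters are even, so \<open>word_less\<close> reduces to comparing letters.\<close>
  also have "\<dots> = (\<Sum>p\<in>?PV. of_bool (?G p) / real N ^ m)"
  proof (rule sum.cong[OF refl])
    fix p assume p: "p \<in> ?PV"
    define v where "v = restrict (c \<circ> p) {..<m}"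
    have w: "v \<in> ?PK" using PiE_mem[OF p] c(1) by (auto simp: v_def)
    have prod: "(\<Prod>j<m. of_bool (c (p j) = w j) / real N) = (if w = v then 1 / real N ^ m else 0)"
      if w': "w \<in> ?PK" for w
    proof (cases "w = v")
      case False
      have "\<exists>j<m. c (p j) \<noteq> w j"
      proof (rule ccontr)
        assume "\<not> (\<exists>j<m. c (p j) \<noteq> w j)"
        then have "w = v" by (intro PiE_ext[OF w' w]) (auto simp: v_def)
        then show False using False by contradiction
      qed
      then obtain j where "j < m" "c (p j) \<noteq> w j" by blast
      then show ?thesis using False by (auto intro!: prod_zero bexI[of _ j])
    qed (simp add: v_def power_one_over)
    have "(\<Sum>w\<in>?PK. (\<Prod>j<m. of_bool (c (p j) = w j) / real N) * of_bool (has_layers (word_less w) {..<m} rs))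
      = (\<Sum>w\<in>?PK. if w = v then of_bool (has_layers (word_less v) {..<m} rs) / real N ^ m else 0)"
      by (intro sum.cong refl) (simp add: prod)
    also have "\<dots> = of_bool (has_layers (word_less v) {..<m} rs) / real N ^ m"
      using w K by (simp add: finite_PiE)
    also have "has_layers (word_less v) {..<m} rs \<longleftrightarrow> ?G p"
      using c(2) by (intro has_layers_cong) (auto simp: word_less_def v_def)
    finally show "(\<Sum>w\<in>?PK. (\<Prod>j<m. of_bool (c (p j) = w j) / real N) * of_bool (has_layers (word_less w) {..<m} rs))
      = of_bool (?G p) / real N ^ m" .
  qed
  also have "\<dots> = real (card {p \<in> ?PV. ?G p}) / real N ^ m"
    by (simp add: of_bool_def sum.If_cases Int_def finite_PiE flip: sum_divide_distrib)
  finally have eq: "word_sum {..<m} K rs (\<lambda>i. real (card {a. a < N \<and> c a = i}) / real N)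
    = real (card {p \<in> ?PV. ?G p}) / real N ^ m" .
  \<comment> \<open>Injective tuples are sorted by their images, which have m points each.\<close>
  let ?\<A> = "{A. A \<subseteq> ?V \<and> card A = m \<and> has_layers ?R A rs}"
  let ?inj = "\<lambda>A. {p \<in> {..<m} \<rightarrow>\<^sub>E A. inj_on p {..<m}}"
  have fin\<A>: "finite ?\<A>" by (rule finite_subset[of _ "Pow ?V"]) auto
  have im: "p ` {..<m} = A" if "A \<in> ?\<A>" "p \<in> ?inj A" for A p
    using that by (intro card_subset_eq) (auto simp: card_image intro: finite_subset)
  have "card (?inj A) = fact m" if "A \<in> ?\<A>" for A
    using card_inj_on_subset_funcset[of "{..<m}" A "{..<m}"] that finite_subset[of A ?V]
    by (simp add: fact_prod_rev)
  then have "fact m * card ?\<A> = (\<Sum>A\<in>?\<A>. card (?inj A))" by simp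
  also have "\<dots> = card (\<Union>A\<in>?\<A>. ?inj A)"
  proof (rule card_UN_disjoint[symmetric, OF fin\<A>])
    show "\<forall>A\<in>?\<A>. finite (?inj A)"
    proof
      fix A assume "A \<in> ?\<A>"
      then have "finite ({..<m} \<rightarrow>\<^sub>E A)" using finite_subset[of A ?V] by (intro finite_PiE) auto
      then show "finite (?inj A)" by (rule finite_subset[rotated]) blast
    qed
    show "\<forall>A\<in>?\<A>. \<forall>B\<in>?\<A>. A \<noteq> B \<longrightarrow> ?inj A \<inter> ?inj B = {}"
    proof (intro ballI impI equals0I)
      fix A B p assume "A \<in> ?\<A>" "B \<in> ?\<A>" "A \<noteq> B" "p \<in> ?inj A \<inter> ?inj B"
      then have "p ` {..<m} = A" "p ` {..<m} = B" using im[of A p] im[of B p] by blast+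
      then show False using \<open>A \<noteq> B\<close> by simp
    qed
  qed
  also have "\<dots> \<le> card {p \<in> ?PV. ?G p}"
  proof (rule card_mono)
    show "(\<Union>A\<in>?\<A>. ?inj A) \<subseteq> {p \<in> ?PV. ?G p}"
    proof
      fix p assume "p \<in> (\<Union>A\<in>?\<A>. ?inj A)"
      then obtain A where A: "A \<in> ?\<A>" "p \<in> ?inj A" by blast
      then have "bij_betw p {..<m} A" using im[OF A] by (auto simp: bij_betw_def)
      then have "?G p \<longleftrightarrow> has_layers ?R A rs" by (rule has_layers_bij) simp
      then show "p \<in> {p \<in> ?PV. ?G p}" using A by (auto simp: PiE_def Pi_def)
    qed
  qed (simp add: finite_PiE)
  finally have le: "fact m * card ?\<A> \<le> card {p \<in> ?PV. ?G p}" .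
  have "fact m * real (card ?\<A>) = real (fact m * card ?\<A>)"
    by (simp only: of_nat_mult of_nat_fact)
  also have "\<dots> \<le> real (card {p \<in> ?PV. ?G p})" using le by (simp only: of_nat_le_iff)
  finally have "fact m * real (card ?\<A>) \<le> real (card {p \<in> ?PV. ?G p})" .
  then show ?thesis unfolding eq by (simp add: divide_right_mono)
qed

text \<open>The left side is the probability that m draws from N points are distinct, a product of
  the factors 1 - i/N with i < m. The bound in k is uniform over all patterns of f.\<close>

lemma fact_choose_ge:
  assumes "m \<le> k" "k \<le> N" "N > 0"
  shows "fact m * real (N choose m) / real N ^ m \<ge> (1 - real k / real N) ^ k"
proof -
  have "fact m * real (N choose m) = (\<Prod>i<m. real N - real i)"
    by (simp add: binomial_gbinomial gbinomial_mult_fact atLeast0LessThan)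
  then have "fact m * real (N choose m) / real N ^ m = (\<Prod>i<m. (real N - real i) / real N)"
    by (simp add: prod_dividef)
  moreover have "(1 - real k / real N) ^ k \<le> (\<Prod>i<m. 1 - real k / real N)"
    using assms by (simp add: power_decreasing)
  moreover have "(\<Prod>i<m. 1 - real k / real N) \<le> (\<Prod>i<m. (real N - real i) / real N)"
    using assms by (intro prod_mono) (auto simp: field_simps)
  ultimately show ?thesis by linarith
qed

text \<open>Since coefficients are nonnegative, the extremal permutation can be symmetrized for all
  patterns at once, and the loss from drawing with replacement can then be estimated pattern by
  pattern.\<close>

lemma max_density_le_price_poly:
  assumes lay: "\<And>\<tau>. \<tau> \<in> Poly_Mapping.keys f \<Longrightarrow> layered \<tau>"
    and nonneg: "\<And>\<tau>. \<tau> \<in> Poly_Mapping.keys f \<Longrightarrow> Poly_Mapping.lookup f \<tau> \<ge> 0"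
    and len: "\<And>\<tau>. \<tau> \<in> Poly_Mapping.keys f \<Longrightarrow> length \<tau> \<le> k"
    and N: "0 < N" "k \<le> N" "N \<le> n" and W: "W \<subseteq> {1..n}"
  shows "\<exists>x\<in>feasible n W. (1 - real k / real N) ^ k * max_density f N \<le> price_poly_comb n f x"
proof -
  let ?K = "{1..2 * n}" and ?F = "Poly_Mapping.keys f" and ?a = "Poly_Mapping.lookup f"
  obtain rs where rs: "\<And>\<tau>. \<tau> \<in> ?F \<Longrightarrow> layer_sequence \<tau> (rs \<tau>)"
    using lay unfolding layered_def by metis
  obtain \<sigma> where \<sigma>: "\<sigma> \<in> perms N" "max_density f N = linear_ext (\<lambda>\<tau>. pattern_density \<tau> \<sigma>) f"
    using max_density_attained by blast
  let ?wt = "\<lambda>\<tau>. ?a \<tau> / real (N choose length \<tau>)"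
  let ?occ = "\<lambda>R \<tau>. real (card {A. A \<subseteq> {..<N} \<and> has_layers R A (rs \<tau>)})"
  have score: "total_score {..<N} ?F ?wt rs R = (\<Sum>\<tau>\<in>?F. ?wt \<tau> * ?occ R \<tau>)" for R
    by (rule total_score_eq) (auto simp: nonneg)
  have "\<exists>h. h ` {..<N} \<subseteq> {..<card {..<N}} \<and>
     total_score {..<N} ?F ?wt rs (up \<sigma>) \<le> total_score {..<N} ?F ?wt rs (\<lambda>a b. h a < (h b :: nat))"
    by (rule symmetrization) (auto simp: nonneg up_def)
  then obtain h where h: "h ` {..<N} \<subseteq> {..<N}"
    "(\<Sum>\<tau>\<in>?F. ?wt \<tau> * ?occ (up \<sigma>) \<tau>) \<le> (\<Sum>\<tau>\<in>?F. ?wt \<tau> * ?occ (\<lambda>a b. h a < h b) \<tau>)"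
    unfolding score by auto
  have "max_density f N = (\<Sum>\<tau>\<in>?F. ?wt \<tau> * ?occ (up \<sigma>) \<tau>)"
    unfolding \<sigma>(2) linear_ext_def using pattern_density_layered[OF rs \<sigma>(1)] by (intro sum.cong) auto
  then have le: "max_density f N \<le> (\<Sum>\<tau>\<in>?F. ?wt \<tau> * ?occ (\<lambda>a b. h a < h b) \<tau>)" using h(2) by simp
  \<comment> \<open>Ranks run from 0 to N - 1, so the letters are even numbers from 2 to 2N, within
    the range because N \<le> n.\<close>
  define c where "c a = 2 * (h a + 1)" for a
  define x where "x i = real (card {a. a < N \<and> c a = i}) / real N" for i
  have cK: "c a \<in> ?K" if "a < N" for a
  proof -
    have "h a < N" using h(1) that by auto
    then show ?thesis using N(3) by (simp add: c_def)
  qed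
  have "x \<in> feasible n W"
  proof -
    have "(\<Sum>j\<in>?K. card {a \<in> {..<N}. c a = j}) = card {..<N}"
      using cK by (subst card_eq_sum[of "{..<N}"], subst sum.group[of "{..<N}" ?K c "\<lambda>_. 1", symmetric]) auto
    then have "(\<Sum>j\<in>?K. real (card {a. a < N \<and> c a = j})) = real N"
      by (simp flip: of_nat_sum)
    then have "(\<Sum>j\<in>?K. x j) = 1"
      unfolding x_def using N(1) by (simp flip: sum_divide_distrib)
    moreover have "x (2 * j - 1) = 0" if "j \<in> W" for j
    proof -
      \<comment> \<open>Here j \<ge> 1 is essential: for j = 0 the truncated difference would be 0,
        which is even.\<close>
      have "odd (2 * j - 1)" using that W by fastforce
      moreover have "even (c a)" for a by (simp add: c_def)
      ultimately have "c a \<noteq> 2 * j - 1" for a by metis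
      then show ?thesis by (simp add: x_def)
    qed
    ultimately show ?thesis by (auto simp: feasible_def x_def)
  qed
  moreover have "(1 - real k / real N) ^ k * max_density f N \<le> price_poly_comb n f x"
  proof -
    have "(1 - real k / real N) ^ k * max_density f N
      \<le> (1 - real k / real N) ^ k * (\<Sum>\<tau>\<in>?F. ?wt \<tau> * ?occ (\<lambda>a b. h a < h b) \<tau>)"
      using le N by (intro mult_left_mono) auto
    also have "\<dots> = (\<Sum>\<tau>\<in>?F. ?a \<tau> * ((1 - real k / real N) ^ k * ?occ (\<lambda>a b. h a < h b) \<tau> / real (N choose length \<tau>)))"
      by (simp add: sum_distrib_left algebra_simps)
    also have "\<dots> \<le> (\<Sum>\<tau>\<in>?F. ?a \<tau> * price_poly n \<tau> x)"
    proof (intro sum_mono mult_left_mono nonneg)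
      fix \<tau> assume \<tau>: "\<tau> \<in> ?F"
      let ?m = "length \<tau>"
      have m: "?m \<le> k" using len[OF \<tau>] .
      then have pos: "real (N choose ?m) > 0" using N by simp
      have occ: "{A. A \<subseteq> {..<N} \<and> has_layers (\<lambda>a b. h a < h b) A (rs \<tau>)}
          = {A. A \<subseteq> {..<N} \<and> card A = ?m \<and> has_layers (\<lambda>a b. c a < c b) A (rs \<tau>)}"
      proof -
        have "card A = ?m" if "A \<subseteq> {..<N}" "has_layers (\<lambda>a b. h a < h b) A (rs \<tau>)" for A
          using has_layers_card[OF that(2)] finite_subset[OF that(1)] layer_sequence_sum_list[OF rs[OF \<tau>]]
          by simp
        then show ?thesis by (auto simp: c_def)
      qed
      have "(1 - real k / real N) ^ k * ?occ (\<lambda>a b. h a < h b) \<tau>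
          \<le> fact ?m * real (N choose ?m) / real N ^ ?m * ?occ (\<lambda>a b. h a < h b) \<tau>"
        using fact_choose_ge[OF m N(2,1)] by (intro mult_right_mono) auto
      then have "(1 - real k / real N) ^ k * ?occ (\<lambda>a b. h a < h b) \<tau> / real (N choose ?m)
          \<le> fact ?m * real (N choose ?m) / real N ^ ?m * ?occ (\<lambda>a b. h a < h b) \<tau> / real (N choose ?m)"
        using pos by (intro divide_right_mono) auto
      also have "\<dots> = fact ?m / real N ^ ?m * ?occ (\<lambda>a b. h a < h b) \<tau>"
        using pos by simp
      also have "\<dots> \<le> word_sum {..<?m} ?K (rs \<tau>) x"
        unfolding occ x_def using N(1) cK by (intro word_sum_ge_occurrences) (auto simp: c_def)
      also have "\<dots> = price_poly n \<tau> x" using price_poly_eq_word_sum[OF rs[OF \<tau>]] by simp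
      finally show "(1 - real k / real N) ^ k * ?occ (\<lambda>a b. h a < h b) \<tau> / real (N choose ?m) \<le> price_poly n \<tau> x" .
    qed
    finally show ?thesis by (simp add: price_poly_comb_def linear_ext_def)
  qed
  ultimately show ?thesis by blast
qed

section \<open>Passing to the limit\<close>

lemma price_poly_comb_eq:
  assumes rs: "\<And>\<tau>. \<tau> \<in> Poly_Mapping.keys f \<Longrightarrow> layer_sequence \<tau> (rs \<tau>)"
  shows "price_poly_comb n f x
    = (\<Sum>\<tau>\<in>Poly_Mapping.keys f. Poly_Mapping.lookup f \<tau> * word_sum {..<length \<tau>} {1..2 * n} (rs \<tau>) x)"
  unfolding price_poly_comb_def linear_ext_def using price_poly_eq_word_sum[OF rs]
  by (intro sum.cong) auto

text \<open>\<open>GREATEST\<close> names the intended value only once a maximum is known to exist.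
  It comes from continuity on a compact set of points.\<close>

lemma price_bound_attained:
  assumes lay: "\<And>\<tau>. \<tau> \<in> Poly_Mapping.keys f \<Longrightarrow> layered \<tau>" and n: "n \<ge> 1"
  shows "price_bound n W f \<in> price_poly_comb n f ` feasible n W"
    and "x \<in> feasible n W \<Longrightarrow> price_poly_comb n f x \<le> price_bound n W f"
proof -
  let ?K = "{1..2 * n}" and ?g = "price_poly_comb n f"
  obtain rs where rs: "\<And>\<tau>. \<tau> \<in> Poly_Mapping.keys f \<Longrightarrow> layer_sequence \<tau> (rs \<tau>)"
    using lay unfolding layered_def by metis
  have g: "?g x = (\<Sum>\<tau>\<in>Poly_Mapping.keys f.
      Poly_Mapping.lookup f \<tau> * word_sum {..<length \<tau>} ?K (rs \<tau>) x)" for x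
    using rs by (rule price_poly_comb_eq)
  \<comment> \<open>\<open>feasible\<close> leaves the coordinates outside 1 to 2n free and is not
    compact. Confining every coordinate to [0, 1] gives a closed part of a compact product.\<close>
  define S where "S = (\<Pi>\<^sub>E i\<in>UNIV. {0..1::real}) \<inter> {x. (\<Sum>j\<in>?K. x j) = 1} \<inter> (\<Inter>j\<in>W. {x. x (2 * j - 1) = 0})"
  have "compact (\<Pi>\<^sub>E i\<in>(UNIV :: nat set). {0..1::real})"
    using compactin_PiE[of "\<lambda>_. euclidean" "UNIV :: nat set" "\<lambda>_. {0..1::real}"]
    by (simp add: euclidean_product_topology)
  then have "compact S"
    unfolding S_def
    by (intro compact_Int_closed closed_INT ballI closed_Collect_eq continuous_on_sum
        continuous_on_product_coordinates continuous_on_const)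
  moreover have "?g = (\<lambda>x. \<Sum>\<tau>\<in>Poly_Mapping.keys f.
      Poly_Mapping.lookup f \<tau> * word_sum {..<length \<tau>} ?K (rs \<tau>) x)"
    by (intro ext g)
  then have "continuous_on S ?g"
    unfolding word_sum_def
    by (simp only:) (intro continuous_intros continuous_on_subset[OF continuous_on_product_coordinates], auto)
  moreover have "S \<noteq> {}"
  proof -
    \<comment> \<open>All mass sits on variable 2. It exists because n \<ge> 1, and no constraint
      touches it because 2 is not of the form 2j - 1.\<close>
    have "(\<lambda>i. of_bool (i = 2)) \<in> S"
      using n by (auto simp: S_def of_bool_def) presburger
    then show ?thesis by blast
  qed
  ultimately obtain y where y: "y \<in> S" "\<And>x. x \<in> S \<Longrightarrow> ?g x \<le> ?g y"
    using continuous_attains_sup[of S ?g] by blast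
  have yf: "y \<in> feasible n W" using y(1) by (auto simp: S_def feasible_def)
  have le: "?g x \<le> ?g y" if x: "x \<in> feasible n W" for x
  proof -
    \<comment> \<open>Setting the free coordinates to 0 moves a feasible point into S and leaves the
      polynomial unchanged.\<close>
    define x' where "x' i = (if i \<in> ?K then x i else 0)" for i
    have "x i \<le> 1" if "i \<in> ?K" for i
      using member_le_sum[OF that, of x] x by (auto simp: feasible_def)
    then have "x' \<in> S" using x by (auto simp: S_def feasible_def x'_def)
    moreover have "word_sum {..<m} ?K r x' = word_sum {..<m} ?K r x" for m r
      unfolding word_sum_def
    proof (rule sum.cong[OF refl])
      fix w assume w: "w \<in> {..<m} \<rightarrow>\<^sub>E ?K"
      have "(\<Prod>p<m. x' (w p)) = (\<Prod>p<m. x (w p))"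
        using PiE_mem[OF w] by (intro prod.cong refl) (simp add: x'_def)
      then show "(\<Prod>p<m. x' (w p)) * of_bool (has_layers (word_less w) {..<m} r)
          = (\<Prod>p<m. x (w p)) * of_bool (has_layers (word_less w) {..<m} r)" by (simp only:)
    qed
    then have "?g x' = ?g x" unfolding g by (simp only:)
    ultimately show ?thesis using y(2)[of x'] by simp
  qed
  have "price_bound n W f = ?g y"
    unfolding price_bound_def using yf le by (intro Greatest_equality) auto
  then show "price_bound n W f \<in> ?g ` feasible n W"
    and "x \<in> feasible n W \<Longrightarrow> ?g x \<le> price_bound n W f"
    using yf le by auto
qed

text \<open>The inequalities L(n) \<le> M(N) for all N \<ge> k and c(n) M(n) \<le> L(n) with c(n)
  tending to 1 suffice. Convergence of the maximal densities is a consequence of them.\<close>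

lemma price_bound_tendsto:
  assumes lay: "\<And>\<tau>. \<tau> \<in> Poly_Mapping.keys f \<Longrightarrow> layered \<tau>"
    and nonneg: "\<And>\<tau>. \<tau> \<in> Poly_Mapping.keys f \<Longrightarrow> Poly_Mapping.lookup f \<tau> \<ge> 0"
    and W: "\<And>n. n \<ge> 1 \<Longrightarrow> W n \<subseteq> {1..n}"
  shows "(\<lambda>n. price_bound n (W n) f) \<longlonglongrightarrow> packing_density f"
proof -
  \<comment> \<open>The inserted 0 keeps the maximum defined when f = 0.\<close>
  define k where "k = Max (insert 0 (length ` Poly_Mapping.keys f))"
  have k: "length \<tau> \<le> k" if "\<tau> \<in> Poly_Mapping.keys f" for \<tau>
    unfolding k_def using that by (intro Max_ge) auto
  let ?L = "\<lambda>n. price_bound n (W n) f" and ?M = "max_density f"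
  let ?c = "\<lambda>n. (1 - real k / real n) ^ k"
  have L_le_M: "?L n \<le> ?M N" if "n \<ge> 1" "N \<ge> k" for n N
  proof -
    have "?L n \<in> price_poly_comb n f ` feasible n (W n)"
      by (rule price_bound_attained(1)[OF lay that(1)])
    then obtain x where x: "x \<in> feasible n (W n)" "?L n = price_poly_comb n f x" by blast
    have "length \<tau> \<le> N" if "\<tau> \<in> Poly_Mapping.keys f" for \<tau> using k[OF that] \<open>N \<ge> k\<close> by simp
    then show ?thesis using price_poly_le_max_density[OF lay _ x(1)] x(2) by simp
  qed
  have le_L: "?c n * ?M n \<le> ?L n" if n: "n > k" for n
  proof -
    have "n \<ge> 1" using n by simp
    then obtain x where "x \<in> feasible n (W n)" "?c n * ?M n \<le> price_poly_comb n f x"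
      using max_density_le_price_poly[of f k n n "W n"] lay nonneg k n W by auto
    then show ?thesis
      using price_bound_attained(2)[of f n x "W n"] lay \<open>n \<ge> 1\<close> by fastforce
  qed
  \<comment> \<open>The infimum starts at k, where every pattern of f fits into the permutation. It
    is finite because the price bound for n = 1 lies below all these densities.\<close>
  define \<mu> where "\<mu> = Inf (?M ` {k..})"
  have bdd: "bdd_below (?M ` {k..})" using L_le_M[of 1] by (auto intro!: bdd_belowI)
  have \<mu>_le: "\<mu> \<le> ?M N" if "N \<ge> k" for N
    unfolding \<mu>_def using bdd that by (intro cInf_lower) auto
  have L_le: "?L n \<le> \<mu>" if "n \<ge> 1" for n
    unfolding \<mu>_def using L_le_M[OF that] by (intro cInf_greatest) auto
  have c0: "?c n > 0" if "n > k" for n using that by (simp add: field_simps)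
  have "(\<lambda>n. 1 - real k / real n) \<longlonglongrightarrow> 1 - 0"
    by (intro tendsto_diff tendsto_const lim_const_over_n)
  then have c: "?c \<longlonglongrightarrow> 1" using tendsto_power[of _ "1 - 0" sequentially k] by fastforce
  have L: "?L \<longlonglongrightarrow> \<mu>"
  proof (rule tendsto_sandwich)
    show "\<forall>\<^sub>F n in sequentially. ?c n * \<mu> \<le> ?L n"
      using eventually_gt_at_top[of k]
    proof eventually_elim
      case (elim n)
      have "?c n * \<mu> \<le> ?c n * ?M n" using c0[OF elim] \<mu>_le[of n] elim by (intro mult_left_mono) auto
      then show ?case using le_L[OF elim] by linarith
    qed
    show "\<forall>\<^sub>F n in sequentially. ?L n \<le> \<mu>"
      using eventually_ge_at_top[of 1] by eventually_elim (rule L_le)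
    show "(\<lambda>n. ?c n * \<mu>) \<longlonglongrightarrow> \<mu>" using tendsto_mult[OF c tendsto_const[of \<mu>]] by simp
  qed simp
  \<comment> \<open>This establishes the limit that \<open>packing_density\<close> takes with
    \<open>lim\<close>.\<close>
  have "?M \<longlonglongrightarrow> \<mu>"
  proof (rule tendsto_sandwich)
    show "\<forall>\<^sub>F n in sequentially. \<mu> \<le> ?M n"
      using eventually_ge_at_top[of k] by eventually_elim (rule \<mu>_le)
    show "\<forall>\<^sub>F n in sequentially. ?M n \<le> ?L n / ?c n"
      using eventually_gt_at_top[of k]
    proof eventually_elim
      case (elim n)
      show ?case using le_L[OF elim] c0[OF elim] by (simp add: pos_le_divide_eq mult.commute)
    qed
    show "(\<lambda>n. ?L n / ?c n) \<longlonglongrightarrow> \<mu>" using tendsto_divide[OF L c] by simp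
  qed simp
  then have "packing_density f = \<mu>"
    unfolding packing_density_def max_density_def[symmetric] by (rule limI)
  then show ?thesis using L by simp
qed

theorem mainTheorem3:
  fixes k :: nat and a :: "nat \<Rightarrow> real" and \<tau> :: "nat \<Rightarrow> nat list"
    and f :: perm_comb and W :: "nat \<Rightarrow> nat set"
  assumes "f = (\<Sum>t=1..k. Poly_Mapping.single (\<tau> t) (a t))"
    and "\<And>t. t \<in> {1..k} \<Longrightarrow> a t \<ge> 0"
    and "\<And>t. t \<in> {1..k} \<Longrightarrow> layered (\<tau> t)"
    and "\<And>n. n \<ge> 1 \<Longrightarrow> W n \<subseteq> {1..n}"
  shows "(\<lambda>n. price_bound n (W n) f) \<longlonglongrightarrow> packing_density f"
proof (rule price_bound_tendsto)
  \<comment> \<open>The \<tau> t may repeat, so a coefficient of f collects all a t that belong to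
    the same pattern.\<close>
  have lookup: "Poly_Mapping.lookup f \<rho> = (\<Sum>t=1..k. if \<tau> t = \<rho> then a t else 0)" for \<rho>
    by (simp add: assms(1) lookup_sum lookup_single when_def)
  show "Poly_Mapping.lookup f \<rho> \<ge> 0" for \<rho>
    unfolding lookup using assms(2) by (intro sum_nonneg) auto
  fix \<rho> assume "\<rho> \<in> Poly_Mapping.keys f"
  then have "(\<Sum>t=1..k. if \<tau> t = \<rho> then a t else 0) \<noteq> 0" by (simp add: lookup flip: lookup_not_eq_zero_eq_in_keys)
  then obtain t where "t \<in> {1..k}" "(if \<tau> t = \<rho> then a t else 0) \<noteq> 0"
    by (rule sum.not_neutral_contains_not_neutral)
  then have "t \<in> {1..k}" "\<tau> t = \<rho>" by (auto split: if_splits)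
  then show "layered \<rho>" using assms(3) by blast
qed (use assms(4) in blast)

end
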